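(* Let $\Omega$ be a measurable set in $\mathbb{R}^d$ of finite measure, and suppose that $\Omega'\subset\mathbb{R}^{d+1}$ is a stacking of $\Omega$, i.e. there are a vector $v\in\mathbb{R}^d$ and an integer $n\geq 1$ such that, with $u=(v,1)\in\mathbb{R}^{d+1}$, $$\Omega'=\Omega\times[0,1]+\{0,u,2u,\dots,(n-1)u\}.$$ If $\Omega'\subset\mathbb{R}^{d+1}$ is spectral, then $\Omega\subset\mathbb{R}^d$ is spectral.
   Context: A measurable set $\Omega\subset\mathbb{R}^m$ of positive, finite Lebesgue measure is spectral if there is a set $\Lambda\subset\mathbb{R}^m$ such that the system $\{e^{2\pi i\lambda\cdot x}\}_{\lambda\in\Lambda}$ is an orthogonal basis for $L^2(\Omega)$. The sum of sets is the Minkowski sum $A+B=\{a+b : a\in A, b\in B\}$. *)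

theory Defs
  imports "HOL-Analysis.Analysis"
begin

text \<open>Elements of \<open>L\<^sup>2(\<Omega>)\<close> are represented by functions on the whole space of which
  only the values on \<open>\<Omega>\<close> matter; two of them are the same element iff \<open>L2_norm \<Omega> (f - g) = 0\<close>.\<close>

definition L2_space :: "'a::euclidean_space set \<Rightarrow> ('a \<Rightarrow> complex) set" where
  "L2_space \<Omega> = {f. f \<in> borel_measurable (lebesgue_on \<Omega>) \<and>
                    integrable (lebesgue_on \<Omega>) (\<lambda>x. (cmod (f x))\<^sup>2)}"

definition L2_inner :: "'a::euclidean_space set \<Rightarrow> ('a \<Rightarrow> complex) \<Rightarrow> ('a \<Rightarrow> complex) \<Rightarrow> complex" where
  "L2_inner \<Omega> f g = (LINT x|lebesgue_on \<Omega>. f x * cnj (g x))"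

definition L2_norm :: "'a::euclidean_space set \<Rightarrow> ('a \<Rightarrow> complex) \<Rightarrow> real" where
  "L2_norm \<Omega> f = sqrt (LINT x|lebesgue_on \<Omega>. (cmod (f x))\<^sup>2)"

text \<open>A family \<open>(e i)\<close>, \<open>i \<in> I\<close>, of nonzero, pairwise orthogonal elements of \<open>L\<^sup>2(\<Omega>)\<close> whose
  finite linear combinations are dense in \<open>L\<^sup>2(\<Omega>)\<close>.\<close>

definition orthogonal_basis_L2 ::
    "'a::euclidean_space set \<Rightarrow> 'i set \<Rightarrow> ('i \<Rightarrow> 'a \<Rightarrow> complex) \<Rightarrow> bool" where
  "orthogonal_basis_L2 \<Omega> I e \<longleftrightarrow>
     (\<forall>i\<in>I. e i \<in> L2_space \<Omega> \<and> L2_norm \<Omega> (e i) \<noteq> 0) \<and>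
     (\<forall>i\<in>I. \<forall>j\<in>I. i \<noteq> j \<longrightarrow> L2_inner \<Omega> (e i) (e j) = 0) \<and>
     (\<forall>f\<in>L2_space \<Omega>. \<forall>\<epsilon>>0. \<exists>F c. finite F \<and> F \<subseteq> I \<and>
        L2_norm \<Omega> (\<lambda>x. f x - (\<Sum>i\<in>F. c i * e i x)) < \<epsilon>)"

definition expo :: "'a::euclidean_space \<Rightarrow> 'a \<Rightarrow> complex" where
  "expo \<xi> x = exp (2 * of_real pi * \<i> * of_real (\<xi> \<bullet> x))"

definition spectral :: "'a::euclidean_space set \<Rightarrow> bool" where
  "spectral \<Omega> \<longleftrightarrow>
     \<Omega> \<in> sets lebesgue \<and> 0 < emeasure lebesgue \<Omega> \<and> emeasure lebesgue \<Omega> < \<infinity> \<and>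
     (\<exists>\<Lambda>. orthogonal_basis_L2 \<Omega> \<Lambda> expo)"

text \<open>\<open>\<real>\<^sup>d\<^sup>+\<^sup>1\<close> is the product \<open>\<real>\<^sup>d \<times> \<real>\<close>, whose library inner product and Lebesgue measure are
  the Euclidean ones. The outer \<open>+\<close> is the Minkowski sum of \<open>HOL-Library.Set_Algebras\<close>.\<close>

definition is_stacking :: "((real ^ 'd) \<times> real) set \<Rightarrow> (real ^ 'd) set \<Rightarrow> bool" where
  "is_stacking \<Omega>' \<Omega> \<longleftrightarrow>
     (\<exists>v :: real ^ 'd. \<exists>n :: nat. n \<ge> 1 \<and>
        \<Omega>' = \<Omega> \<times> {0..1} + (\<lambda>k. real k *\<^sub>R (v, 1)) ` {..<n})"

end

theory Submission
  imports Defs "HOL-Probability.Sinc_Integral" "HOL-Real_Asymp.Real_Asymp"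
begin

text \<open>Let \<open>\<Lambda>\<close> be a spectrum of \<open>\<Omega>'\<close>, and for \<open>\<lambda> = (\<xi>, s)\<close> in \<open>\<Lambda>\<close> put \<open>t = \<lambda> \<bullet> u\<close>. The Fourier
  transform of \<open>\<Omega>'\<close> at \<open>\<lambda>\<close> is that of \<open>\<Omega>\<close> at \<open>\<xi>\<close>, times that of \<open>[0,1]\<close> at \<open>s\<close>, times the
  Dirichlet kernel \<open>D\<^sub>n(t)\<close>, which vanishes only if \<open>n t\<close> is an integer and \<open>t\<close> is not. Hence the
  \<open>\<xi>\<close>'s with \<open>s \<in> [a, a+1)\<close> and \<open>t mod 1 \<in> [j/n, (j+1)/n)\<close> give orthogonal exponentials on \<open>\<Omega>\<close>.
  By Bessel's inequality the measure \<open>\<nu>\<close> with mass \<open>|\<langle>h, e\<^sub>\<xi>\<rangle>|\<^sup>2\<close> at \<open>s\<close> gives each such window at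
  most \<open>C = |\<Omega>| \<parallel>h\<parallel>\<^sup>2\<close>, so it gives \<open>[a, a+1)\<close> at most \<open>n C\<close>.
  Parseval's identity on \<open>\<Omega>'\<close> for the function \<open>h(x) exp(2 \<pi> i a y)\<close>, supported on the lowest
  slab \<open>\<Omega> \<times> [0,1)\<close>, says that the integral of \<open>sinc\<^sup>2(\<pi>(s - a))\<close> against \<open>\<nu>\<close> equals \<open>n C\<close>.
  Since \<open>sinc\<^sup>2(\<pi> s)\<close> and the indicator of \<open>[0,1)\<close> both have integral 1, a packing by the latter at
  the level at which the former tiles is itself a tiling. So every window attains its bound, which
  is Parseval's identity on \<open>\<Omega>\<close> for the \<open>\<xi>\<close>'s of the window \<open>a = 0\<close>, \<open>j = 0\<close>.\<close>

section \<open>Packing and tiling on the real line\<close>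

text \<open>Integrating \<open>sin x ^ 2 / x ^ 2\<close> by parts leaves the boundary term
  \<open>- sin x * sinc x\<close> and the integral of \<open>sin (2 * x) / x\<close>, which is
  \<open>Si (2 * x)\<close>. The quotient rule fails at \<open>0\<close>, so that point is treated
  separately.\<close>

lemma DERIV_Si_minus_sin_sinc:
  "((\<lambda>x. Si (2 * x) - sin x * sinc x) has_real_derivative (sinc x)\<^sup>2) (at x)"
proof -
  have Si: "((\<lambda>x. Si (2 * x)) has_real_derivative sinc (2 * x) * 2) (at x)"
    by (rule DERIV_chain'[OF _ DERIV_Si]) (auto intro!: derivative_eq_intros)
  show ?thesis
  proof (cases "x = 0")
    case True
    \<comment> \<open>Caratheodory's slope function is \<open>(sinc x)\<^sup>2\<close>, because
      \<open>sin x * sinc x = (sinc x)\<^sup>2 * x\<close>; it is continuous with value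
      \<open>1\<close> at \<open>0\<close>. The \<open>Si\<close> term has derivative
      \<open>2\<close> there, so the difference is \<open>1\<close>.\<close>
    have "((\<lambda>x. sin x * sinc x) has_real_derivative 1) (at 0)"
      unfolding CARAT_DERIV
      by (rule exI[of _ "\<lambda>x. (sinc x)\<^sup>2"])
         (auto intro!: continuous_intros isCont_sinc simp: power2_eq_square)
    from DERIV_diff[OF Si[unfolded True] this] show ?thesis
      by (simp add: True)
  next
    case False
    have "((\<lambda>x. sin x * (sin x / x)) has_real_derivative
        cos x * (sin x / x) + (cos x * x - sin x) / (x * x) * sin x) (at x)"
      using False by (auto intro!: derivative_eq_intros simp: divide_simps algebra_simps)
    then have "((\<lambda>x. sin x * sinc x) has_real_derivative
        cos x * (sin x / x) + (cos x * x - sin x) / (x * x) * sin x) (at x)"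
      by (rule DERIV_cong_ev[THEN iffD1, rotated -1])
         (use False t1_space_nhds[OF False] in \<open>auto elim: eventually_mono\<close>)
    from DERIV_diff[OF Si this] show ?thesis
      using False sin_double[of x]
      by (simp add: power2_eq_square field_simps)
  qed
qed

text \<open>The antiderivative vanishes at \<open>0\<close> and inherits the limit
  \<open>pi / 2\<close> from \<open>Si\<close>, which settles one half-line; evenness of the
  integrand gives the other.\<close>

lemma nn_integral_sinc_squared: "(\<integral>\<^sup>+x. ennreal ((sinc x)\<^sup>2) \<partial>lborel) = ennreal pi"
proof -
  let ?F = "\<lambda>x. Si (2 * x) - sin x * sinc x"
  have "filterlim (\<lambda>x::real. 2 * x) at_top at_top"
    by real_asymp
  from filterlim_compose[OF Si_at_top this]
  have "((\<lambda>x. Si (2 * x)) \<longlongrightarrow> pi / 2) at_top" .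
  moreover have "((\<lambda>x::real. sin x * sinc x) \<longlongrightarrow> 0) at_top"
  proof (rule Lim_null_comparison)
    show "\<forall>\<^sub>F x::real in at_top. norm (sin x * sinc x) \<le> 1 / x"
      using eventually_gt_at_top[of 0]
    proof eventually_elim
      case (elim x)
      have "\<bar>sin x\<bar> * \<bar>sin x\<bar> \<le> 1 * 1" by (intro mult_mono) auto
      then show ?case using elim by (simp add: abs_mult divide_simps)
    qed
    show "((\<lambda>x::real. 1 / x) \<longlongrightarrow> 0) at_top" by real_asymp
  qed
  ultimately have lim: "(?F \<longlongrightarrow> pi / 2) at_top"
    using tendsto_diff by fastforce
  have half: "(\<integral>\<^sup>+x. ennreal ((sinc x)\<^sup>2) * indicator {0..} x \<partial>lborel) = ennreal (pi / 2)"
  proof -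
    have "(\<integral>\<^sup>+x. ennreal ((sinc x)\<^sup>2) * indicator {0..} x \<partial>lborel) = pi / 2 - ?F 0"
      by (rule nn_integral_FTC_atLeast[OF _ _ _ lim]) (use DERIV_Si_minus_sin_sinc in auto)
    then show ?thesis by (simp add: Si_def flip: zero_ereal_def)
  qed
  have half': "(\<integral>\<^sup>+x. ennreal ((sinc x)\<^sup>2) * indicator {..<0} x \<partial>lborel) = ennreal (pi / 2)"
  proof -
    have "(\<integral>\<^sup>+x. ennreal ((sinc x)\<^sup>2) * indicator {..<0} x \<partial>lborel)
      = (\<integral>\<^sup>+x. ennreal ((sinc (0 + -1 * x))\<^sup>2) * indicator {..<0} (0 + -1 * x) \<partial>lborel)"
      by (subst nn_integral_real_affine[where c="-1" and t=0]) simp_all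
    \<comment> \<open>Reflection turns \<open>{..<0}\<close> into \<open>{0<..}\<close>, which
      differs from \<open>{0..}\<close> only in the null point \<open>0\<close>.\<close>
    also have "\<dots> = (\<integral>\<^sup>+x. ennreal ((sinc x)\<^sup>2) * indicator {0..} x \<partial>lborel)"
      by (rule nn_integral_cong_AE, use AE_lborel_singleton[of 0] in eventually_elim)
         (auto split: split_indicator)
    finally show ?thesis using half by simp
  qed
  have "(\<integral>\<^sup>+x. ennreal ((sinc x)\<^sup>2) \<partial>lborel) = (\<integral>\<^sup>+x. ennreal ((sinc x)\<^sup>2) * indicator {0..} x
     + ennreal ((sinc x)\<^sup>2) * indicator {..<0} x \<partial>lborel)"
    by (rule nn_integral_cong) (auto split: split_indicator)
  also have "\<dots> = ennreal (pi / 2) + ennreal (pi / 2)"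
    by (subst nn_integral_add) (simp_all only: half half', simp_all)
  finally show ?thesis by (simp flip: ennreal_plus)
qed

lemma nn_integral_sinc_pi_squared: "(\<integral>\<^sup>+x. ennreal ((sinc (pi * x))\<^sup>2) \<partial>lborel) = 1"
proof -
  have "ennreal pi = ennreal pi * (\<integral>\<^sup>+x. ennreal ((sinc (pi * x))\<^sup>2) \<partial>lborel)"
    using nn_integral_real_affine[where c=pi and t=0 and f="\<lambda>x. ennreal ((sinc x)\<^sup>2)"]
    by (simp add: nn_integral_sinc_squared cong: if_cong)
  then have "ennreal pi * 1 = ennreal pi * (\<integral>\<^sup>+x. ennreal ((sinc (pi * x))\<^sup>2) \<partial>lborel)"
    by simp
  then show ?thesis
    using pi_gt_zero by (subst (asm) ennreal_mult_cancel_left) (auto simp: ennreal_eq_0_iff)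
qed

text \<open>Fubini turns the integral of \<open>k a * \<nu> [a, a + 1)\<close> over \<open>a\<close> into the average over \<open>r \<in> [0, 1)\<close> of
  the integrals of \<open>k (x - r)\<close> against \<open>\<nu>\<close>, so it equals \<open>C\<close>, the largest value the packing bound allows.\<close>

lemma packing_imp_tiling:
  fixes \<nu> :: "real measure" and k :: "real \<Rightarrow> ennreal" and C :: ennreal
  assumes [measurable_cong]: "sets \<nu> = sets borel"
    and [measurable]: "k \<in> borel_measurable borel" and k_int: "(\<integral>\<^sup>+x. k x \<partial>lborel) = 1"
    and k_pos: "AE x in lborel. 0 < k x" and C: "C < \<infinity>"
    and tiling: "\<And>a. (\<integral>\<^sup>+x. k (x - a) \<partial>\<nu>) = C"
    and packing: "\<And>a. emeasure \<nu> {a..<a + 1} \<le> C"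
  shows "emeasure \<nu> {a..<a + 1} = C"
proof -
  have [measurable]: "k \<in> borel_measurable lborel" by simp
  let ?M = "\<lambda>a. emeasure \<nu> {a..<a + 1}"
  \<comment> \<open>Fubini needs sigma-finiteness. The packing bound provides it: the unit intervals
    with integer endpoints cover the line and have finite mass.\<close>
  interpret \<nu>: sigma_finite_measure \<nu>
  proof
    let ?A = "range (\<lambda>m::int. {real_of_int m..<real_of_int m + 1})"
    have "x \<in> \<Union>?A" for x :: real
      by (intro UnionI[of "{of_int \<lfloor>x\<rfloor>..<of_int \<lfloor>x\<rfloor> + 1}"]) auto
    moreover have "emeasure \<nu> {a..<a + 1} \<noteq> \<infinity>" for a
      using packing[of a] C by (auto simp: top_unique)
    ultimately show "\<exists>A. countable A \<and> A \<subseteq> sets \<nu> \<and> \<Union>A = space \<nu> \<and> (\<forall>a\<in>A. emeasure \<nu> a \<noteq> \<infinity>)"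
      using sets_eq_imp_space_eq[OF assms(1)]
      by (intro exI[of _ ?A]) (auto simp: assms(1))
  qed
  interpret pair_sigma_finite \<nu> lborel ..
  have M_eq: "?M a = (\<integral>\<^sup>+x. indicator {0..<1} (x - a) \<partial>\<nu>)" for a
  proof -
    have "(indicator {0..<1} (x - a) :: ennreal) = indicator {a..<a + 1} x" for x
      by (auto split: split_indicator)
    then show ?thesis by (simp add: assms(1))
  qed
  have M_meas [measurable]: "?M \<in> borel_measurable borel"
    unfolding M_eq by measurable
  \<comment> \<open>Substituting \<open>a = x - r\<close> frees the indicator of \<open>x\<close>;
    once the integrals are exchanged, the inner one is the tiling integral.\<close>
  have shift: "(\<integral>\<^sup>+a. indicator {0..<1} (x - a) * k a \<partial>lborel)
      = (\<integral>\<^sup>+r. indicator {0..<1} r * k (x - r) \<partial>lborel)" for x :: real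
    by (subst nn_integral_real_affine[where c="-1" and t=x])
       (auto intro!: nn_integral_cong split: split_indicator)
  have "(\<integral>\<^sup>+a. ?M a * k a \<partial>lborel) = (\<integral>\<^sup>+a. (\<integral>\<^sup>+x. indicator {0..<1} (x - a) * k a \<partial>\<nu>) \<partial>lborel)"
    unfolding M_eq by (intro nn_integral_cong nn_integral_multc[symmetric]) measurable
  also have "\<dots> = (\<integral>\<^sup>+x. (\<integral>\<^sup>+a. indicator {0..<1} (x - a) * k a \<partial>lborel) \<partial>\<nu>)"
    by (rule Fubini') measurable
  also have "\<dots> = (\<integral>\<^sup>+x. (\<integral>\<^sup>+r. indicator {0..<1} r * k (x - r) \<partial>lborel) \<partial>\<nu>)"
    by (simp only: shift)
  also have "\<dots> = (\<integral>\<^sup>+r. (\<integral>\<^sup>+x. indicator {0..<1} r * k (x - r) \<partial>\<nu>) \<partial>lborel)"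
    by (rule Fubini'[symmetric]) measurable
  also have "\<dots> = (\<integral>\<^sup>+r. indicator {0..<1::real} r * C \<partial>lborel)"
    by (subst nn_integral_cmult) (simp_all add: tiling)
  also have "\<dots> = C"
    by (subst nn_integral_multc) simp_all
  finally have int_M: "(\<integral>\<^sup>+a. ?M a * k a \<partial>lborel) = C" .
  have int_C: "(\<integral>\<^sup>+a. C * k a \<partial>lborel) = C"
    by (subst nn_integral_cmult) (simp_all add: k_int)
  \<comment> \<open>Packing gives the reverse inequality everywhere. Both sides have the same finite
    integral \<open>C\<close>, so strict inequality on a set of positive measure is
    impossible.\<close>
  have "AE a in lborel. C * k a \<le> ?M a * k a"
  proof (rule ccontr)
    assume "\<not> ?thesis"
    then have "(\<integral>\<^sup>+a. ?M a * k a \<partial>lborel) < (\<integral>\<^sup>+a. C * k a \<partial>lborel)"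
      using C by (intro nn_integral_less) (auto simp: int_M packing intro!: mult_right_mono)
    then show False by (simp add: int_M int_C)
  qed
  \<comment> \<open>Cancelling \<open>k a\<close> in \<open>ennreal\<close> requires it to be finite
    as well as positive.\<close>
  moreover have "AE a in lborel. k a \<noteq> \<infinity>"
    by (rule nn_integral_PInf_AE) (simp_all add: k_int)
  ultimately have ae: "AE a in lborel. ?M a = C"
    using k_pos
  proof eventually_elim
    case (elim a)
    then have "C \<le> ?M a"
      by (subst (asm) (1 2) mult.commute, subst (asm) ennreal_mult_le_mult_iff) auto
    then show ?case using packing[of a] by simp
  qed
  txt \<open>\<open>?M\<close> is left-continuous, so the equality extends from almost every point to all points.\<close>
  let ?D = "\<lambda>i::nat. {a - 1 / real (Suc i)..<a}"
  have "(\<Inter>i. ?D i) = {}"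
  proof (safe, goal_cases)
    case (1 x)
    then have "x < a" by auto
    then obtain i where "inverse (real (Suc i)) < a - x"
      using reals_Archimedean[of "a - x"] by auto
    moreover have "a - 1 / real (Suc i) \<le> x" using 1 by auto
    ultimately show ?case by (simp add: inverse_eq_divide)
  qed
  moreover have "(\<lambda>i. emeasure \<nu> (?D i)) \<longlonglongrightarrow> emeasure \<nu> (\<Inter>i. ?D i)"
  proof (rule Lim_emeasure_decseq)
    show "range ?D \<subseteq> sets \<nu>" by (auto simp: assms(1))
    show "decseq ?D" by (auto simp: decseq_def frac_le intro: order_trans[rotated])
    fix i
    have "1 / real (Suc i) \<le> 1" by simp
    then have "emeasure \<nu> (?D i) \<le> ?M (a - 1)"
      by (intro emeasure_mono) (auto simp: assms(1) simp del: of_nat_Suc)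
    then show "emeasure \<nu> (?D i) \<noteq> \<infinity>"
      using packing[of "a - 1"] C by (auto simp: top_unique)
  qed
  ultimately have "(\<lambda>i. emeasure \<nu> (?D i) + ?M a) \<longlonglongrightarrow> 0 + ?M a"
    by (intro tendsto_intros) auto
  moreover have "C \<le> emeasure \<nu> (?D i) + ?M a" for i
  proof -
    \<comment> \<open>An interval of positive length meets every set of full measure. The window at
      such an \<open>a'\<close> is covered by \<open>?D i\<close> and the window at
      \<open>a\<close>.\<close>
    have "\<exists>a'\<in>{a - 1 / real (Suc i)<..<a}. ?M a' = C"
    proof (rule ccontr)
      assume *: "\<not> ?thesis"
      from ae have "AE x in lborel. x \<notin> {a - 1 / real (Suc i)<..<a}"
        by eventually_elim (use * in auto)
      then have "{a - 1 / real (Suc i)<..<a} \<in> null_sets lborel"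
        by (subst AE_iff_null_sets) auto
      then have "emeasure lborel {a - 1 / real (Suc i)<..<a} = 0" by (rule null_setsD1)
      moreover have "emeasure lborel {a - 1 / real (Suc i)<..<a} = ennreal (1 / real (Suc i))"
        by (subst emeasure_lborel_Ioo) (auto simp del: of_nat_Suc)
      ultimately show False by (simp del: of_nat_Suc)
    qed
    then obtain a' where a': "a - 1 / real (Suc i) < a'" "a' < a" "?M a' = C" by auto
    have "?M a' \<le> emeasure \<nu> (?D i \<union> {a..<a + 1})"
      using a' by (intro emeasure_mono) (auto simp: assms(1))
    also have "\<dots> \<le> emeasure \<nu> (?D i) + ?M a"
      by (rule emeasure_subadditive) (auto simp: assms(1))
    finally show ?thesis using a' by simp
  qed
  ultimately have "C \<le> 0 + ?M a"
    by (intro LIMSEQ_le_const) auto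
  then show ?thesis using packing[of a] by simp
qed

text \<open>Links the measure built from a spectrum, whose index set is not assumed countable, to
  the finite sums in which Bessel and Parseval are stated. A simple function below \<open>f\<close>
  either has finite support, and its integral is a finite sum, or forces the supremum to be
  infinite.\<close>

lemma nn_integral_count_space_eq_SUP:
  fixes f :: "'a \<Rightarrow> ennreal"
  shows "(\<integral>\<^sup>+i. f i \<partial>count_space I) = (SUP F\<in>{F. finite F \<and> F \<subseteq> I}. \<Sum>i\<in>F. f i)"
    (is "?L = ?R")
proof (rule antisym)
  show "?R \<le> ?L"
  proof (rule SUP_least)
    fix F assume "F \<in> {F. finite F \<and> F \<subseteq> I}"
    then have "(\<Sum>i\<in>F. f i) = (\<integral>\<^sup>+i. f i * indicator F i \<partial>count_space I)"
      by (subst nn_integral_count_space'[where A=F]) auto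
    also have "\<dots> \<le> ?L"
      by (intro nn_integral_mono) (auto split: split_indicator)
    finally show "(\<Sum>i\<in>F. f i) \<le> ?L" .
  qed
  have sum_le: "(\<Sum>i\<in>F. f i) \<le> ?R" if "finite F" "F \<subseteq> I" for F
    using that by (intro SUP_upper) auto
  show "?L \<le> ?R"
    unfolding nn_integral_def
  proof (rule SUP_least, clarify)
    fix g :: "'a \<Rightarrow> ennreal"
    assume g: "simple_function (count_space I) g" "g \<le> f"
    show "integral\<^sup>S (count_space I) g \<le> ?R"
    proof (cases "finite {i\<in>I. 0 < g i}")
      case True
      have "integral\<^sup>S (count_space I) g = (\<Sum>i | i \<in> I \<and> 0 < g i. g i)"
        using nn_integral_count_space[OF True] g(1) by (simp add: nn_integral_eq_simple_integral)
      also have "\<dots> \<le> (\<Sum>i | i \<in> I \<and> 0 < g i. f i)"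
        using g(2) by (intro sum_mono) (auto simp: le_fun_def)
      also have "\<dots> \<le> ?R" by (rule sum_le) (use True in auto)
      finally show ?thesis .
    next
      case False
      \<comment> \<open>A simple function has finite range, so some positive value recurs infinitely
        often, and finite sums over its level set grow without bound.\<close>
      have "finite (g ` {i\<in>I. 0 < g i})"
        using g(1) by (auto intro: finite_subset)
      from pigeonhole_infinite[OF False this]
      obtain j where j: "0 < g j" "infinite {i\<in>{i\<in>I. 0 < g i}. g i = g j}" by blast
      have "of_nat N * g j \<le> ?R" for N
      proof -
        obtain F where F: "F \<subseteq> {i\<in>{i\<in>I. 0 < g i}. g i = g j}" "finite F" "card F = N"
          using infinite_arbitrarily_large[OF j(2)] by blast
        have "of_nat N * g j = (\<Sum>i\<in>F. g i)"
          using F by (subst sum.cong[OF refl, of F g "\<lambda>_. g j"]) auto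
        also have "\<dots> \<le> (\<Sum>i\<in>F. f i)"
          using g(2) by (intro sum_mono) (auto simp: le_fun_def)
        also have "\<dots> \<le> ?R" using F by (intro sum_le) auto
        finally show ?thesis .
      qed
      then have "(SUP N. of_nat N * g j) \<le> ?R" by (intro SUP_least)
      moreover have "(SUP N. of_nat N * g j) = \<infinity>"
        using j(1) by (subst SUP_mult_right_ennreal[symmetric])
          (simp add: ennreal_SUP_of_nat_eq_top ennreal_top_mult)
      ultimately have "?R = \<infinity>" by (simp only: infinity_ennreal_def top_unique)
      then show ?thesis by (simp only: infinity_ennreal_def top_greatest)
    qed
  qed
qed

section \<open>Bessel and Parseval\<close>

lemma borel_measurable_cnj [measurable]: "cnj \<in> borel_measurable borel"
  by (intro borel_measurable_continuous_onI continuous_intros)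

lemma L2_spaceD:
  assumes "f \<in> L2_space \<Omega>"
  shows "f \<in> borel_measurable (lebesgue_on \<Omega>)" "integrable (lebesgue_on \<Omega>) (\<lambda>x. (cmod (f x))\<^sup>2)"
  using assms by (auto simp: L2_space_def)

lemma L2_inner_integrable:
  assumes f: "f \<in> L2_space \<Omega>" and g: "g \<in> L2_space \<Omega>"
  shows "integrable (lebesgue_on \<Omega>) (\<lambda>x. f x * cnj (g x))"
proof (rule Bochner_Integration.integrable_bound)
  show "integrable (lebesgue_on \<Omega>) (\<lambda>x. (cmod (f x))\<^sup>2 + (cmod (g x))\<^sup>2)"
    using f g by (auto dest: L2_spaceD)
  show "(\<lambda>x. f x * cnj (g x)) \<in> borel_measurable (lebesgue_on \<Omega>)"
    using L2_spaceD(1)[OF f, measurable] L2_spaceD(1)[OF g, measurable] by measurable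
  have "cmod a * cmod b \<le> (cmod a)\<^sup>2 + (cmod b)\<^sup>2" for a b
    using sum_squares_bound[of "cmod a" "cmod b"] zero_le_power2[of "cmod a"]
      zero_le_power2[of "cmod b"] by linarith
  then show "AE x in lebesgue_on \<Omega>. norm (f x * cnj (g x)) \<le> norm ((cmod (f x))\<^sup>2 + (cmod (g x))\<^sup>2)"
    by (simp add: norm_mult)
qed

lemma L2_space_scale: "f \<in> L2_space \<Omega> \<Longrightarrow> (\<lambda>x. c * f x) \<in> L2_space \<Omega>"
  by (auto simp: L2_space_def norm_mult power_mult_distrib)

lemma L2_space_add:
  assumes f: "f \<in> L2_space \<Omega>" and g: "g \<in> L2_space \<Omega>"
  shows "(\<lambda>x. f x + g x) \<in> L2_space \<Omega>"
proof -
  note [measurable] = L2_spaceD(1)[OF f] L2_spaceD(1)[OF g]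
  have "integrable (lebesgue_on \<Omega>) (\<lambda>x. (cmod (f x + g x))\<^sup>2)"
  proof (rule Bochner_Integration.integrable_bound)
    show "integrable (lebesgue_on \<Omega>) (\<lambda>x. 2 * ((cmod (f x))\<^sup>2 + (cmod (g x))\<^sup>2))"
      by (intro Bochner_Integration.integrable_add integrable_mult_right L2_spaceD(2) f g)
    have "(cmod (a + b))\<^sup>2 \<le> 2 * ((cmod a)\<^sup>2 + (cmod b)\<^sup>2)" for a b
    proof -
      have "(cmod (a + b))\<^sup>2 \<le> (cmod a + cmod b)\<^sup>2"
        by (intro power_mono norm_triangle_ineq) auto
      also have "\<dots> \<le> 2 * ((cmod a)\<^sup>2 + (cmod b)\<^sup>2)"
        using sum_squares_bound[of "cmod a" "cmod b"] by (simp add: power2_sum)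
      finally show ?thesis .
    qed
    then show "AE x in lebesgue_on \<Omega>. norm ((cmod (f x + g x))\<^sup>2)
        \<le> norm (2 * ((cmod (f x))\<^sup>2 + (cmod (g x))\<^sup>2))"
      by simp
  qed simp
  then show ?thesis by (simp add: L2_space_def)
qed

lemma L2_space_sum:
  assumes "\<And>i. i \<in> F \<Longrightarrow> e i \<in> L2_space \<Omega>"
  shows "(\<lambda>x. \<Sum>i\<in>F. c i * e i x) \<in> L2_space \<Omega>"
  using assms
proof (induction F rule: infinite_finite_induct)
  case (insert j F)
  then show ?case
    using L2_space_add[OF L2_space_scale[of "e j" \<Omega> "c j"]] by simp
qed (auto simp: L2_space_def)

lemma L2_inner_self: "L2_inner \<Omega> f f = complex_of_real ((L2_norm \<Omega> f)\<^sup>2)"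
proof -
  have "(L2_norm \<Omega> f)\<^sup>2 = (LINT x|lebesgue_on \<Omega>. (cmod (f x))\<^sup>2)"
    unfolding L2_norm_def by (intro real_sqrt_pow2 Bochner_Integration.integral_nonneg) auto
  then show ?thesis
    by (simp add: L2_inner_def complex_norm_square[symmetric] flip: of_real_power)
qed

lemma L2_inner_commute: "L2_inner \<Omega> g f = cnj (L2_inner \<Omega> f g)"
  unfolding L2_inner_def by (simp add: mult.commute flip: Bochner_Integration.integral_cnj)

lemma L2_inner_sum_left:
  assumes "\<And>i. i \<in> F \<Longrightarrow> e i \<in> L2_space \<Omega>" "f \<in> L2_space \<Omega>"
  shows "L2_inner \<Omega> (\<lambda>x. \<Sum>i\<in>F. c i * e i x) f = (\<Sum>i\<in>F. c i * L2_inner \<Omega> (e i) f)"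
proof -
  have "L2_inner \<Omega> (\<lambda>x. \<Sum>i\<in>F. c i * e i x) f
      = (LINT x|lebesgue_on \<Omega>. (\<Sum>i\<in>F. c i * (e i x * cnj (f x))))"
    unfolding L2_inner_def by (simp add: sum_distrib_right mult.assoc)
  also have "\<dots> = (\<Sum>i\<in>F. LINT x|lebesgue_on \<Omega>. c i * (e i x * cnj (f x)))"
    by (intro Bochner_Integration.integral_sum integrable_mult_right L2_inner_integrable assms)
  finally show ?thesis by (simp add: L2_inner_def)
qed

text \<open>Expand the square and complete it in each coefficient. The last sum is the excess over
  the best approximation, attained at \<open>c i = L2_inner \<Omega> f (e i) / V\<close>. The common
  squared norm is \<open>V\<close> instead of \<open>1\<close> because exponentials on a set have
  its measure as squared norm.\<close>

lemma L2_norm_diff_sum: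
  fixes c :: "'i \<Rightarrow> complex"
  assumes fin: "finite F" and f: "f \<in> L2_space \<Omega>" and e: "\<And>i. i \<in> F \<Longrightarrow> e i \<in> L2_space \<Omega>"
    and orth: "\<And>i j. i \<in> F \<Longrightarrow> j \<in> F \<Longrightarrow> i \<noteq> j \<Longrightarrow> L2_inner \<Omega> (e i) (e j) = 0"
    and norm: "\<And>i. i \<in> F \<Longrightarrow> L2_inner \<Omega> (e i) (e i) = complex_of_real V" and V: "V > 0"
  shows "(L2_norm \<Omega> (\<lambda>x. f x - (\<Sum>i\<in>F. c i * e i x)))\<^sup>2 =
    (L2_norm \<Omega> f)\<^sup>2 - (\<Sum>i\<in>F. (cmod (L2_inner \<Omega> f (e i)))\<^sup>2) / V
      + (\<Sum>i\<in>F. (cmod (V * c i - L2_inner \<Omega> f (e i)))\<^sup>2) / V"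
proof -
  define g where "g = (\<lambda>x. \<Sum>i\<in>F. c i * e i x)"
  have g: "g \<in> L2_space \<Omega>"
    unfolding g_def using e by (rule L2_space_sum)
  have gf: "L2_inner \<Omega> g f = (\<Sum>i\<in>F. c i * cnj (L2_inner \<Omega> f (e i)))"
    unfolding g_def using e f
    by (subst L2_inner_sum_left) (auto simp: L2_inner_commute[of \<Omega> "e _" f])
  have "L2_inner \<Omega> (e i) g = V * cnj (c i)" if i: "i \<in> F" for i
  proof -
    have "L2_inner \<Omega> g (e i) = (\<Sum>j\<in>F. c j * L2_inner \<Omega> (e j) (e i))"
      unfolding g_def using e i by (intro L2_inner_sum_left) auto
    also have "\<dots> = (\<Sum>j\<in>F. if j = i then V * c i else 0)"
      using orth norm i by (intro sum.cong) auto
    also have "\<dots> = V * c i" using fin i by simp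
    finally show ?thesis by (subst L2_inner_commute) simp
  qed
  then have gg: "L2_inner \<Omega> g g = (\<Sum>i\<in>F. c i * (V * cnj (c i)))"
    using g e by (subst g_def, subst L2_inner_sum_left) auto
  have "L2_inner \<Omega> (\<lambda>x. f x - g x) (\<lambda>x. f x - g x)
      = (LINT x|lebesgue_on \<Omega>. (f x * cnj (f x) - f x * cnj (g x)) - (g x * cnj (f x) - g x * cnj (g x)))"
    unfolding L2_inner_def by (intro Bochner_Integration.integral_cong) (auto simp: algebra_simps)
  also have "\<dots> = (L2_inner \<Omega> f f - L2_inner \<Omega> f g) - (L2_inner \<Omega> g f - L2_inner \<Omega> g g)"
    unfolding L2_inner_def using f g
    by (subst Bochner_Integration.integral_diff Bochner_Integration.integrable_diff;
        (intro Bochner_Integration.integrable_diff L2_inner_integrable)?; simp?)+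
  finally have "(L2_norm \<Omega> (\<lambda>x. f x - g x))\<^sup>2
      = (L2_norm \<Omega> f)\<^sup>2 - 2 * Re (L2_inner \<Omega> g f) + Re (L2_inner \<Omega> g g)"
    by (simp add: L2_inner_self complex_eq_iff L2_inner_commute[of \<Omega> f g])
  moreover have "- 2 * Re (L2_inner \<Omega> g f) + Re (L2_inner \<Omega> g g)
    = (\<Sum>i\<in>F. ((cmod (V * c i - L2_inner \<Omega> f (e i)))\<^sup>2 - (cmod (L2_inner \<Omega> f (e i)))\<^sup>2) / V)"
  proof -
    \<comment> \<open>This is the completed square for a single coefficient.\<close>
    have *: "- 2 * Re (c * cnj a) + Re (c * (V * cnj c)) = ((cmod (V * c - a))\<^sup>2 - (cmod a)\<^sup>2) / V"
      for c a :: complex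
    proof -
      have "(cmod (V * c - a))\<^sup>2 - (cmod a)\<^sup>2 = V * (- 2 * Re (c * cnj a) + Re (c * (V * cnj c)))"
        unfolding cmod_power2 by (simp add: power2_eq_square algebra_simps)
      then show ?thesis using V by simp
    qed
    show ?thesis
      by (simp only: gf gg Re_sum sum_distrib_left flip: sum.distrib) (intro sum.cong refl *)
  qed
  ultimately show ?thesis
    by (simp add: g_def sum_subtractf diff_divide_distrib flip: sum_divide_distrib)
qed

text \<open>With the optimal coefficients the excess term of \<open>L2_norm_diff_sum\<close>
  vanishes, and what remains is a square, hence nonnegative.\<close>

lemma Bessel_inequality:
  fixes e :: "'i \<Rightarrow> 'a::euclidean_space \<Rightarrow> complex"
  assumes "finite F" "f \<in> L2_space \<Omega>" "\<And>i. i \<in> F \<Longrightarrow> e i \<in> L2_space \<Omega>"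
    and "\<And>i j. i \<in> F \<Longrightarrow> j \<in> F \<Longrightarrow> i \<noteq> j \<Longrightarrow> L2_inner \<Omega> (e i) (e j) = 0"
    and "\<And>i. i \<in> F \<Longrightarrow> L2_inner \<Omega> (e i) (e i) = complex_of_real V" and V: "V > 0"
  shows "(\<Sum>i\<in>F. (cmod (L2_inner \<Omega> f (e i)))\<^sup>2) \<le> V * (L2_norm \<Omega> f)\<^sup>2"
proof -
  let ?c = "\<lambda>i. L2_inner \<Omega> f (e i) / V"
  have "(L2_norm \<Omega> (\<lambda>x. f x - (\<Sum>i\<in>F. ?c i * e i x)))\<^sup>2 =
    (L2_norm \<Omega> f)\<^sup>2 - (\<Sum>i\<in>F. (cmod (L2_inner \<Omega> f (e i)))\<^sup>2) / V
      + (\<Sum>i\<in>F. (cmod (V * ?c i - L2_inner \<Omega> f (e i)))\<^sup>2) / V"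
    by (rule L2_norm_diff_sum) (use assms in \<open>blast+\<close>)
  then have "(\<Sum>i\<in>F. (cmod (L2_inner \<Omega> f (e i)))\<^sup>2) / V \<le> (L2_norm \<Omega> f)\<^sup>2"
    using V zero_le_power2[of "L2_norm \<Omega> (\<lambda>x. f x - (\<Sum>i\<in>F. ?c i * e i x))"] by simp
  then show ?thesis
    using V by (simp add: field_simps)
qed

text \<open>Replaces density of linear combinations by Parseval's identity, phrased as finite sums
  coming arbitrarily close to the Bessel bound. In this form the basis property of the stack enters
  the tiling argument and that of the base leaves it.\<close>

lemma orthogonal_basis_L2_iff_Parseval:
  fixes e :: "'i \<Rightarrow> 'a::euclidean_space \<Rightarrow> complex"
  assumes e: "\<And>i. i \<in> I \<Longrightarrow> e i \<in> L2_space \<Omega>"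
    and norm: "\<And>i. i \<in> I \<Longrightarrow> L2_inner \<Omega> (e i) (e i) = complex_of_real V" and V: "V > 0"
  shows "orthogonal_basis_L2 \<Omega> I e \<longleftrightarrow>
    (\<forall>i\<in>I. \<forall>j\<in>I. i \<noteq> j \<longrightarrow> L2_inner \<Omega> (e i) (e j) = 0) \<and>
    (\<forall>f\<in>L2_space \<Omega>. \<forall>\<epsilon>>0. \<exists>F. finite F \<and> F \<subseteq> I \<and>
      V * (L2_norm \<Omega> f)\<^sup>2 - \<epsilon> < (\<Sum>i\<in>F. (cmod (L2_inner \<Omega> f (e i)))\<^sup>2))"
    (is "_ \<longleftrightarrow> ?orth \<and> ?parseval")
proof -
  have nz: "L2_norm \<Omega> (e i) \<noteq> 0" if "i \<in> I" for i
    using norm[OF that] V by (auto simp: L2_inner_self)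
  have diff: "(L2_norm \<Omega> (\<lambda>x. f x - (\<Sum>i\<in>F. c i * e i x)))\<^sup>2 =
    (L2_norm \<Omega> f)\<^sup>2 - (\<Sum>i\<in>F. (cmod (L2_inner \<Omega> f (e i)))\<^sup>2) / V
      + (\<Sum>i\<in>F. (cmod (V * c i - L2_inner \<Omega> f (e i)))\<^sup>2) / V"
    if "finite F" "F \<subseteq> I" "f \<in> L2_space \<Omega>" ?orth for F f and c :: "'i \<Rightarrow> complex"
  proof (rule L2_norm_diff_sum[OF that(1,3) _ _ _ V])
    fix i assume "i \<in> F"
    then have i: "i \<in> I" using that(2) by blast
    show "e i \<in> L2_space \<Omega>" using i by (rule e)
    show "L2_inner \<Omega> (e i) (e i) = complex_of_real V" using i by (rule norm)
    show "L2_inner \<Omega> (e i) (e j) = 0" if "j \<in> F" "i \<noteq> j" for j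
      using that i \<open>F \<subseteq> I\<close> \<open>?orth\<close> by blast
  qed
  have nonneg: "L2_norm \<Omega> f \<ge> 0" for f
    unfolding L2_norm_def by (intro real_sqrt_ge_zero Bochner_Integration.integral_nonneg) auto
  have "(\<forall>\<epsilon>>0. \<exists>F c. finite F \<and> F \<subseteq> I \<and> L2_norm \<Omega> (\<lambda>x. f x - (\<Sum>i\<in>F. c i * e i x)) < \<epsilon>) \<longleftrightarrow>
    (\<forall>\<epsilon>>0. \<exists>F. finite F \<and> F \<subseteq> I \<and>
      V * (L2_norm \<Omega> f)\<^sup>2 - \<epsilon> < (\<Sum>i\<in>F. (cmod (L2_inner \<Omega> f (e i)))\<^sup>2))" (is "?L \<longleftrightarrow> ?R")
    if f: "f \<in> L2_space \<Omega>" and orth: ?orth for f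
  proof (intro iffI allI impI)
    fix \<epsilon> :: real assume ?L "\<epsilon> > 0"
    \<comment> \<open>The tolerance is chosen so that \<open>V\<close> times its square is
      \<open>\<epsilon>\<close>.\<close>
    then have "sqrt (\<epsilon> / V) > 0" using V by simp
    with \<open>?L\<close> obtain F c where F: "finite F" "F \<subseteq> I"
      and lt: "L2_norm \<Omega> (\<lambda>x. f x - (\<Sum>i\<in>F. c i * e i x)) < sqrt (\<epsilon> / V)" by meson
    have "(L2_norm \<Omega> (\<lambda>x. f x - (\<Sum>i\<in>F. c i * e i x)))\<^sup>2 < (sqrt (\<epsilon> / V))\<^sup>2"
      using lt nonneg by (intro power_strict_mono) auto
    also have "\<dots> = \<epsilon> / V" using V \<open>\<epsilon> > 0\<close> by simp
    finally have *: "(L2_norm \<Omega> f)\<^sup>2 - (\<Sum>i\<in>F. (cmod (L2_inner \<Omega> f (e i)))\<^sup>2) / V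
      + (\<Sum>i\<in>F. (cmod (V * c i - L2_inner \<Omega> f (e i)))\<^sup>2) / V < \<epsilon> / V"
      unfolding diff[OF F f orth] .
    \<comment> \<open>Dropping this term expresses that no coefficients do better than the optimal
      ones.\<close>
    have "0 \<le> (\<Sum>i\<in>F. (cmod (V * c i - L2_inner \<Omega> f (e i)))\<^sup>2) / V"
      using V by (intro divide_nonneg_pos sum_nonneg) auto
    with * have "(L2_norm \<Omega> f)\<^sup>2 - (\<Sum>i\<in>F. (cmod (L2_inner \<Omega> f (e i)))\<^sup>2) / V < \<epsilon> / V"
      by linarith
    then have "V * ((L2_norm \<Omega> f)\<^sup>2 - (\<Sum>i\<in>F. (cmod (L2_inner \<Omega> f (e i)))\<^sup>2) / V) < V * (\<epsilon> / V)"
      using V by (rule mult_strict_left_mono)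
    then have "V * (L2_norm \<Omega> f)\<^sup>2 - \<epsilon> < (\<Sum>i\<in>F. (cmod (L2_inner \<Omega> f (e i)))\<^sup>2)"
      using V by (simp add: right_diff_distrib)
    with F show "\<exists>F. finite F \<and> F \<subseteq> I \<and>
      V * (L2_norm \<Omega> f)\<^sup>2 - \<epsilon> < (\<Sum>i\<in>F. (cmod (L2_inner \<Omega> f (e i)))\<^sup>2)"
      by (intro exI[of _ F] conjI)
  next
    fix \<epsilon> :: real assume ?R "\<epsilon> > 0"
    then have "V * \<epsilon>\<^sup>2 > 0" using V by simp
    with \<open>?R\<close> obtain F where F: "finite F" "F \<subseteq> I"
      and lt: "V * (L2_norm \<Omega> f)\<^sup>2 - V * \<epsilon>\<^sup>2 < (\<Sum>i\<in>F. (cmod (L2_inner \<Omega> f (e i)))\<^sup>2)" by meson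
    \<comment> \<open>The optimal coefficients again, so that the excess term is zero.\<close>
    let ?c = "\<lambda>i. L2_inner \<Omega> f (e i) / V"
    have "(L2_norm \<Omega> (\<lambda>x. f x - (\<Sum>i\<in>F. ?c i * e i x)))\<^sup>2 < \<epsilon>\<^sup>2"
    proof -
      have "(\<Sum>i\<in>F. (cmod (V * ?c i - L2_inner \<Omega> f (e i)))\<^sup>2) = 0"
        using V by simp
      moreover have "V * (L2_norm \<Omega> f)\<^sup>2 / V - V * \<epsilon>\<^sup>2 / V < (\<Sum>i\<in>F. (cmod (L2_inner \<Omega> f (e i)))\<^sup>2) / V"
        using divide_strict_right_mono[OF lt V] by (simp only: diff_divide_distrib)
      ultimately show ?thesis
        unfolding diff[OF F f orth] using V by simp
    qed
    then have "L2_norm \<Omega> (\<lambda>x. f x - (\<Sum>i\<in>F. ?c i * e i x)) < \<epsilon>"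
      by (rule power_less_imp_less_base) (use \<open>\<epsilon> > 0\<close> in simp)
    with F show "\<exists>F c. finite F \<and> F \<subseteq> I \<and> L2_norm \<Omega> (\<lambda>x. f x - (\<Sum>i\<in>F. c i * e i x)) < \<epsilon>"
      by (intro exI[of _ F] exI[of _ ?c] conjI)
  qed
  then have "?orth \<Longrightarrow>
    (\<forall>f\<in>L2_space \<Omega>. \<forall>\<epsilon>>0. \<exists>F c. finite F \<and> F \<subseteq> I \<and>
      L2_norm \<Omega> (\<lambda>x. f x - (\<Sum>i\<in>F. c i * e i x)) < \<epsilon>) \<longleftrightarrow> ?parseval"
    by (intro ball_cong refl)
  moreover have "\<forall>i\<in>I. e i \<in> L2_space \<Omega> \<and> L2_norm \<Omega> (e i) \<noteq> 0"
    using e nz by blast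
  ultimately show ?thesis
    unfolding orthogonal_basis_L2_def by satx
qed

section \<open>Fourier transform of a stacking\<close>

lemma norm_expo [simp]: "cmod (expo \<xi> x) = 1"
  by (simp add: expo_def)

lemma expo_0 [simp]: "expo 0 x = 1"
  by (simp add: expo_def)

lemma expo_mult_cnj: "expo \<xi> x * cnj (expo \<eta> x) = expo (\<xi> - \<eta>) x"
  unfolding expo_def exp_cnj exp_add[symmetric]
  by (rule arg_cong[where f=exp]) (simp add: inner_diff_left right_diff_distrib)

lemma expo_add: "expo \<xi> (x + y) = expo \<xi> x * expo \<xi> y"
  unfolding expo_def exp_add[symmetric]
  by (rule arg_cong[where f=exp]) (simp add: inner_add_right distrib_left)

lemma expo_Pair: "expo (\<alpha>, \<beta>) (x, y) = expo \<alpha> x * expo \<beta> y"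
  unfolding expo_def exp_add[symmetric]
  by (rule arg_cong[where f=exp]) (simp add: distrib_left)

lemma borel_measurable_expo [measurable]: "expo \<xi> \<in> borel_measurable borel"
  unfolding expo_def by measurable

lemma borel_measurable_lebesgue_on:
  "f \<in> borel_measurable borel \<Longrightarrow> f \<in> borel_measurable (lebesgue_on \<Omega>)"
  by (simp add: measurable_completion measurable_restrict_space1)

lemma expo_in_L2_space:
  fixes \<Omega> :: "'a::euclidean_space set"
  assumes "\<Omega> \<in> lmeasurable"
  shows "expo \<xi> \<in> L2_space \<Omega>"
proof -
  have "integrable lebesgue (indicator \<Omega> :: 'a \<Rightarrow> real)"
    using assms by (intro integrable_real_indicator) (auto simp: fmeasurable_def)
  then show ?thesis
    using assms
    by (simp add: L2_space_def borel_measurable_lebesgue_on integrable_restrict_space fmeasurableD)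
qed

lemma L2_inner_expo: "L2_inner \<Omega> (expo \<xi>) (expo \<eta>) = (LINT x|lebesgue_on \<Omega>. expo (\<xi> - \<eta>) x)"
  by (simp add: L2_inner_def expo_mult_cnj)

lemma L2_inner_expo_self:
  assumes "\<Omega> \<in> lmeasurable"
  shows "L2_inner \<Omega> (expo \<xi>) (expo \<xi>) = complex_of_real (measure lebesgue \<Omega>)"
  using assms by (simp add: L2_inner_expo measure_restrict_space fmeasurableD scaleR_conv_of_real)

text \<open>The interval is half-open so that slabs at consecutive integer heights are disjoint. The
  positive sign in the exponent fits \<open>L2_inner_expo\<close>, where frequencies enter through
  their difference.\<close>

definition unit_fourier :: "real \<Rightarrow> complex" where
  "unit_fourier b = (LINT s|lborel. indicator {0..<1} s *\<^sub>R expo b s)"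

text \<open>The integral is \<open>(exp (2 * pi * \<i> * b) - 1) / (2 * pi * \<i> * b)\<close>, and
  the numerator has modulus \<open>2 * \<bar>sin (pi * b)\<bar>\<close>. Closing the interval for
  the fundamental theorem of calculus adds only a null point.\<close>

lemma norm_unit_fourier: "(cmod (unit_fourier b))\<^sup>2 = (sinc (pi * b))\<^sup>2"
proof (cases "b = 0")
  case True
  then show ?thesis by (simp add: unit_fourier_def)
next
  case False
  let ?F = "\<lambda>s. exp (2 * of_real pi * \<i> * of_real (b * s)) / (2 * of_real pi * \<i> * of_real b)"
  have "has_bochner_integral lborel (\<lambda>s. indicator {0..1} s *\<^sub>R expo b s) (?F 1 - ?F 0)"
  proof (rule has_bochner_integral_FTC_Icc)
    fix s :: real
    show "(?F has_vector_derivative expo b s) (at s within {0..1})"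
      unfolding expo_def of_real_mult inner_real_def using False
      by (intro has_vector_derivative_real_field) (auto intro!: derivative_eq_intros)
  qed (auto simp: expo_def intro!: continuous_intros)
  moreover have "unit_fourier b = (LINT s|lborel. indicator {0..1} s *\<^sub>R expo b s)"
    unfolding unit_fourier_def
  proof (rule Bochner_Integration.integral_cong_AE)
    show "AE s in lborel. indicator {0..<1} s *\<^sub>R expo b s = indicator {0..1} s *\<^sub>R expo b s"
      using AE_lborel_singleton[of 1] by eventually_elim (auto split: split_indicator)
  qed auto
  ultimately have *: "unit_fourier b = (exp (2 * of_real pi * \<i> * of_real b) - 1) / (2 * of_real pi * \<i> * of_real b)"
    by (simp add: has_bochner_integral_integral_eq diff_divide_distrib)
  have "exp (2 * of_real pi * \<i> * of_real b) = cis (2 * (pi * b))"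
    by (simp add: cis_conv_exp algebra_simps)
  moreover have "(cmod (cis (2 * t) - 1))\<^sup>2 = 4 * (sin t)\<^sup>2" for t
  proof -
    have ring: "(1 - 2 * s\<^sup>2 - 1)\<^sup>2 + (2 * s * c)\<^sup>2 = 4 * s\<^sup>2 * (s\<^sup>2 + c\<^sup>2)" for s c :: real
      by (simp add: power2_eq_square algebra_simps)
    have "(cmod (cis (2 * t) - 1))\<^sup>2 = (cos (2 * t) - 1)\<^sup>2 + (sin (2 * t))\<^sup>2"
      by (simp add: cmod_power2)
    also have "\<dots> = 4 * (sin t)\<^sup>2 * ((sin t)\<^sup>2 + (cos t)\<^sup>2)"
      unfolding cos_double_sin sin_double by (rule ring)
    finally show ?thesis by simp
  qed
  ultimately have "(cmod (unit_fourier b))\<^sup>2 = 4 * (sin (pi * b))\<^sup>2 / (2 * pi * b)\<^sup>2"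
    unfolding * by (simp add: norm_divide norm_mult power_divide power_mult_distrib)
  then show ?thesis using False by (simp add: power_divide power_mult_distrib)
qed

section \<open>Product integrals, Borel representatives and translations\<close>

lemma lborel_integral_product:
  fixes f :: "'a::euclidean_space \<Rightarrow> complex" and g :: "'b::euclidean_space \<Rightarrow> complex"
  assumes f: "integrable lborel f" and g: "integrable lborel g"
  shows "integrable lborel (\<lambda>z. f (fst z) * g (snd z))"
    and "(LINT z|lborel. f (fst z) * g (snd z)) = (LINT x|lborel. f x) * (LINT y|lborel. g y)"
proof -
  note [measurable] = borel_measurable_integrable[OF f] borel_measurable_integrable[OF g]
  have int: "integrable (lborel \<Otimes>\<^sub>M lborel) (\<lambda>z. f (fst z) * g (snd z))"
    using f g by (intro lborel_pair.Fubini_integrable) (auto simp: norm_mult)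
  then show "integrable lborel (\<lambda>z. f (fst z) * g (snd z))"
    by (simp only: lborel_prod)
  show "(LINT z|lborel. f (fst z) * g (snd z)) = (LINT x|lborel. f x) * (LINT y|lborel. g y)"
    using lborel_pair.integral_fst'[OF int] by (simp add: lborel_prod)
qed

text \<open>Moves integrals from the completed measure on \<Omega> to a Borel function on the whole
  space, where Fubini and translation invariance are available.\<close>

lemma
  fixes g G :: "'a::euclidean_space \<Rightarrow> 'b::{banach, second_countable_topology}"
  assumes \<Omega>: "\<Omega> \<in> sets lebesgue" and g: "g \<in> borel_measurable (lebesgue_on \<Omega>)"
    and G: "G \<in> borel_measurable borel" and ae: "AE x in lborel. G x = indicator \<Omega> x *\<^sub>R g x"
  shows integral_lebesgue_on_eq_lborel: "(LINT x|lebesgue_on \<Omega>. g x) = (LINT x|lborel. G x)"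
    and integrable_lebesgue_on_iff_lborel: "integrable (lebesgue_on \<Omega>) g \<longleftrightarrow> integrable lborel G"
proof -
  have m: "(\<lambda>x. indicator \<Omega> x *\<^sub>R g x) \<in> borel_measurable lebesgue"
    using g \<Omega> by (simp add: borel_measurable_restrict_space_iff)
  have m': "G \<in> borel_measurable lebesgue"
    using G by (simp add: measurable_completion)
  have ae': "AE x in lebesgue. G x = indicator \<Omega> x *\<^sub>R g x"
    using ae by (rule AE_completion)
  show "(LINT x|lebesgue_on \<Omega>. g x) = (LINT x|lborel. G x)"
    using G \<Omega> Bochner_Integration.integral_cong_AE[OF m' m ae']
    by (simp add: integral_restrict_space integral_completion)
  show "integrable (lebesgue_on \<Omega>) g \<longleftrightarrow> integrable lborel G"
    using G \<Omega> Bochner_Integration.integrable_cong_AE[OF m' m ae']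
    by (simp add: integrable_restrict_space integrable_completion)
qed

lemma AE_lborel_translate:
  fixes c :: "'a::euclidean_space"
  assumes "AE x in lborel. P x"
  shows "AE x in lborel. P (c + x)"
  using assms by (subst (asm) lborel_distr_plus[of c, symmetric]) (auto dest: AE_distrD[rotated])

lemma lborel_integral_translate:
  fixes f :: "'a::euclidean_space \<Rightarrow> 'b::{banach, second_countable_topology}"
  assumes "f \<in> borel_measurable borel"
  shows "(LINT x|lborel. f (c + x)) = (LINT x|lborel. f x)"
proof -
  have "(LINT x|lborel. f x) = (LINT x|distr lborel borel ((+) c). f x)"
    by (simp only: lborel_distr_plus)
  also have "\<dots> = (LINT x|lborel. f (c + x))"
    using assms by (subst integral_distr) auto
  finally show ?thesis ..
qed

lemma Times_UNIV_null_sets_lborel: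
  fixes N :: "'a::euclidean_space set"
  assumes "N \<in> null_sets lborel"
  shows "N \<times> (UNIV :: 'b::euclidean_space set) \<in> null_sets lborel"
proof -
  have "N \<in> sets lborel" "emeasure lborel N = 0" using assms by auto
  then have "emeasure (lborel \<Otimes>\<^sub>M lborel) (N \<times> (UNIV :: 'b set)) = 0"
    and "N \<times> (UNIV :: 'b set) \<in> sets (lborel \<Otimes>\<^sub>M lborel)"
    by (simp_all add: lborel.emeasure_pair_measure_Times del: UNIV_Times_UNIV)
  then show ?thesis unfolding lborel_prod by (rule null_setsI)
qed

lemma UNIV_Times_null_sets_lborel:
  fixes N :: "'b::euclidean_space set"
  assumes "N \<in> null_sets lborel"
  shows "(UNIV :: 'a::euclidean_space set) \<times> N \<in> null_sets lborel"
proof -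
  have "N \<in> sets lborel" "emeasure lborel N = 0" using assms by auto
  then have "emeasure (lborel \<Otimes>\<^sub>M lborel) ((UNIV :: 'a set) \<times> N) = 0"
    and "(UNIV :: 'a set) \<times> N \<in> sets (lborel \<Otimes>\<^sub>M lborel)"
    by (simp_all add: lborel.emeasure_pair_measure_Times del: UNIV_Times_UNIV)
  then show ?thesis unfolding lborel_prod by (rule null_setsI)
qed

text \<open>Copy \<open>k\<close> occupies heights from \<open>k\<close> to \<open>k + 1\<close>, so
  the copies overlap only in horizontal faces. Removing the top faces and replacing \<Omega> by
  \<open>S\<close> changes a null set and makes the copies disjoint, which lets their indicators add
  up.\<close>

lemma stacking_indicator_AE:
  fixes S \<Omega> :: "(real ^ 'd) set"
  assumes \<Omega>': "\<Omega>' = \<Omega> \<times> {0..1} + (\<lambda>k. real k *\<^sub>R (v, 1)) ` {..<n}"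
    and S: "S \<subseteq> \<Omega>" "\<Omega> - S \<subseteq> N" "N \<in> null_sets lborel"
  shows "AE z in lborel. indicator \<Omega>' z
    = (\<Sum>k<n. indicator (S \<times> {0..<1::real}) (- (real k *\<^sub>R (v, 1)) + z) :: real)"
proof -
  let ?u = "\<lambda>k. real k *\<^sub>R (v, 1::real)"
  have "AE z in lborel. z \<notin> N \<times> (UNIV :: real set) \<and> z \<notin> (UNIV :: (real ^ 'd) set) \<times> {1::real}"
    using S(3) by (intro AE_conjI AE_not_in Times_UNIV_null_sets_lborel UNIV_Times_null_sets_lborel) auto
  then have "AE z in lborel. - ?u k + z \<notin> N \<times> UNIV \<and> - ?u k + z \<notin> UNIV \<times> {1::real}" for k
    by (rule AE_lborel_translate[where c="- ?u k" and
          P="\<lambda>z. z \<notin> N \<times> UNIV \<and> z \<notin> UNIV \<times> {1::real}"])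
  \<comment> \<open>One null set serves all translates, since there are countably many.\<close>
  then have "AE z in lborel. \<forall>k::nat. - ?u k + z \<notin> N \<times> UNIV \<and> - ?u k + z \<notin> UNIV \<times> {1::real}"
    by (simp only: AE_all_countable simp_thms)
  then show ?thesis
  proof eventually_elim
    case (elim z)
    let ?P = "\<lambda>k. - ?u k + z \<in> S \<times> {0..<1::real}"
    have "z \<in> \<Omega>' \<longleftrightarrow> (\<exists>k<n. z - ?u k \<in> \<Omega> \<times> {0..1})"
    proof
      assume "z \<in> \<Omega>'"
      then obtain p q where pq: "z = p + q" "p \<in> \<Omega> \<times> {0..1}" "q \<in> ?u ` {..<n}"
        unfolding \<Omega>' by (rule set_plus_elim)
      from pq(3) obtain k where k: "q = ?u k" "k \<in> {..<n}" by (rule imageE)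
      have "z - ?u k = p" unfolding pq(1) k(1) by (rule add_diff_cancel_right')
      then show "\<exists>k<n. z - ?u k \<in> \<Omega> \<times> {0..1}"
        using pq(2) k(2) by (intro exI[of _ k]) (simp only: lessThan_iff simp_thms)
    next
      assume "\<exists>k<n. z - ?u k \<in> \<Omega> \<times> {0..1}"
      then obtain k where k: "k < n" "z - ?u k \<in> \<Omega> \<times> {0..1}"
        by (elim exE conjE)
      have "(z - ?u k) + ?u k \<in> \<Omega>'"
        unfolding \<Omega>' by (rule set_plus_intro[OF k(2) image_eqI[OF refl]]) (simp add: k(1))
      then show "z \<in> \<Omega>'" by (simp only: diff_add_cancel)
    qed
    moreover have "z - ?u k \<in> \<Omega> \<times> {0..1} \<longleftrightarrow> ?P k" for k
    proof -
      obtain x s where xs: "z - ?u k = (x, s)" by (cases "z - ?u k")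
      then have z: "- ?u k + z = (x, s)" by (simp only: uminus_add_conv_diff)
      have "- ?u k + z \<notin> N \<times> UNIV \<and> - ?u k + z \<notin> UNIV \<times> {1::real}"
        using elim by (rule spec)
      then have "x \<notin> N" "s \<noteq> 1" unfolding z by simp_all
      then have "x \<in> \<Omega> \<longleftrightarrow> x \<in> S" "0 \<le> s \<and> s \<le> 1 \<longleftrightarrow> 0 \<le> s \<and> s < 1" using S by auto
      then show ?thesis
        unfolding z xs by simp
    qed
    ultimately have mem: "z \<in> \<Omega>' \<longleftrightarrow> (\<exists>k<n. ?P k)" by simp
    \<comment> \<open>The height of \<open>z\<close> determines the copy: it lies in both
      \<open>[k, k + 1)\<close> and \<open>[l, l + 1)\<close>.\<close>
    have uniq: "k = l" if "?P k" "?P l" for k l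
    proof -
      have "0 \<le> snd z - real k \<and> snd z - real k < 1" "0 \<le> snd z - real l \<and> snd z - real l < 1"
        using that by (simp_all add: mem_Times_iff)
      then have "real k < real (Suc l)" "real l < real (Suc k)" by linarith+
      then show ?thesis unfolding of_nat_less_iff by simp
    qed
    show ?case
    proof (cases "z \<in> \<Omega>'")
      case True
      then obtain k where k: "k < n" "?P k" unfolding mem by (elim exE conjE)
      have "(\<Sum>k<n. indicator (S \<times> {0..<1::real}) (- ?u k + z)) = (\<Sum>l<n. if l = k then 1 else 0 :: real)"
      proof (rule sum.cong[OF refl])
        fix l
        show "indicator (S \<times> {0..<1::real}) (- ?u l + z) = (if l = k then 1 else 0 :: real)"
        proof (cases "l = k")
          case True
          then show ?thesis using k(2) by (simp only: indicator_simps if_True refl)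
        next
          case False
          then have "\<not> ?P l" using uniq[OF _ k(2)] by metis
          from indicator_simps(2)[OF this] show ?thesis using False by (simp only: if_False)
        qed
      qed
      then show ?thesis using True k by simp
    next
      case False
      then have "indicator (S \<times> {0..<1::real}) (- ?u k + z) = (0 :: real)" if "k < n" for k
        using mem that by (metis indicator_simps(2))
      then show ?thesis using False by simp
    qed
  qed
qed

lemma lebesgue_ex_borel_subset:
  fixes \<Omega> :: "'a::euclidean_space set"
  assumes "\<Omega> \<in> sets lebesgue"
  obtains S N where "S \<in> sets borel" "S \<subseteq> \<Omega>" "\<Omega> - S \<subseteq> N" "N \<in> null_sets lborel"
proof -
  from assms obtain S N N' where "\<Omega> = S \<union> N" "N \<subseteq> N'" "N' \<in> null_sets lborel" "S \<in> sets lborel"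
    by (rule sets_completionE)
  then show ?thesis using that[of S N'] by auto
qed

text \<open>Translating by \<open>real k *\<^sub>R (v, 1)\<close> multiplies the integral by the
  exponential at that vector, and over a product the integral factors by Fubini. The sum over
  \<open>k\<close> is the Dirichlet kernel.\<close>

lemma integral_expo_stacking:
  fixes \<Omega> :: "(real ^ 'd) set"
  assumes \<Omega>': "\<Omega>' = \<Omega> \<times> {0..1} + (\<lambda>k. real k *\<^sub>R (v, 1)) ` {..<n}" "\<Omega>' \<in> sets lebesgue"
    and \<Omega>: "\<Omega> \<in> lmeasurable"
  shows "(LINT z|lebesgue_on \<Omega>'. expo (\<alpha>, \<beta>) z)
    = (\<Sum>k<n. expo (\<alpha>, \<beta>) (real k *\<^sub>R (v, 1))) * ((LINT x|lebesgue_on \<Omega>. expo \<alpha> x) * unit_fourier \<beta>)"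
proof -
  let ?u = "\<lambda>k. real k *\<^sub>R (v, 1::real)"
  have \<Omega>_sets: "\<Omega> \<in> sets lebesgue" and fin: "emeasure lebesgue \<Omega> < \<infinity>"
    using \<Omega> by (auto simp: fmeasurable_def)
  from \<Omega>_sets obtain S N where S: "S \<in> sets borel" "S \<subseteq> \<Omega>" "\<Omega> - S \<subseteq> N" "N \<in> null_sets lborel"
    by (rule lebesgue_ex_borel_subset)
  note [measurable] = S(1)
  define Q where "Q = S \<times> {0..<1::real}"
  have [measurable]: "Q \<in> sets borel"
    unfolding Q_def borel_prod[symmetric] by (intro pair_measureI) auto
  have "emeasure lebesgue S \<le> emeasure lebesgue \<Omega>"
    using S \<Omega>_sets by (intro emeasure_mono) auto
  then have "emeasure lborel S < \<infinity>" using fin S by simp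
  then have int1: "integrable lborel (\<lambda>x. indicator S x *\<^sub>R expo \<alpha> x)"
    using S by (intro integrableI_bounded_set_indicator[where B=1]) auto
  have int2: "integrable lborel (\<lambda>s. indicator {0..<1} s *\<^sub>R expo \<beta> s)" for \<beta> :: real
    by (intro integrableI_bounded_set_indicator[where B=1]) auto
  have prod_eq: "indicator Q z *\<^sub>R expo (\<alpha>, \<beta>) z
      = (indicator S (fst z) *\<^sub>R expo \<alpha> (fst z)) * (indicator {0..<1} (snd z) *\<^sub>R expo \<beta> (snd z))" for z
    by (cases z) (simp add: Q_def expo_Pair indicator_times)
  have base: "(LINT x|lborel. indicator S x *\<^sub>R expo \<alpha> x) = (LINT x|lebesgue_on \<Omega>. expo \<alpha> x)"
  proof (rule integral_lebesgue_on_eq_lborel[symmetric])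
    show "AE x in lborel. indicator S x *\<^sub>R expo \<alpha> x = indicator \<Omega> x *\<^sub>R expo \<alpha> x"
      using AE_not_in[OF S(4)] by eventually_elim (use S in \<open>auto simp: indicator_def\<close>)
  qed (use S \<Omega>_sets in \<open>auto intro: borel_measurable_lebesgue_on\<close>)
  have Q_int: "integrable lborel (\<lambda>z. indicator Q z *\<^sub>R expo (\<alpha>, \<beta>) z)"
    unfolding prod_eq by (rule lborel_integral_product(1)[OF int1 int2])
  have Q_eq: "(LINT z|lborel. indicator Q z *\<^sub>R expo (\<alpha>, \<beta>) z)
      = (LINT x|lebesgue_on \<Omega>. expo \<alpha> x) * unit_fourier \<beta>"
    unfolding prod_eq lborel_integral_product(2)[OF int1 int2] base unit_fourier_def ..
  \<comment> \<open>Evaluated at the translated point, the prefactor is absorbed and the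
    \<open>k\<close>-th summand of the stack appears (\<open>g_eq\<close>); evaluated at
    \<open>w\<close>, it is a constant times the integrand over the lowest slab.\<close>
  let ?g = "\<lambda>k w. expo (\<alpha>, \<beta>) (?u k) * (indicator Q w *\<^sub>R expo (\<alpha>, \<beta>) w)"
  let ?G = "\<lambda>z. \<Sum>k<n. ?g k (- ?u k + z)"
  have g_eq: "?g k (- ?u k + z) = indicator Q (- ?u k + z) *\<^sub>R expo (\<alpha>, \<beta>) z" for k z
  proof -
    have "expo (\<alpha>, \<beta>) (?u k) * expo (\<alpha>, \<beta>) (- ?u k + z) = expo (\<alpha>, \<beta>) z"
      unfolding expo_add[symmetric] add_minus_cancel ..
    then show ?thesis by (simp add: mult.left_commute scaleR_conv_of_real)
  qed
  have g_meas [measurable]: "?g k \<in> borel_measurable borel" for k by measurable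
  have "(LINT z|lebesgue_on \<Omega>'. expo (\<alpha>, \<beta>) z) = (LINT z|lborel. ?G z)"
  proof (rule integral_lebesgue_on_eq_lborel)
    show "AE z in lborel. ?G z = indicator \<Omega>' z *\<^sub>R expo (\<alpha>, \<beta>) z"
      using stacking_indicator_AE[OF \<Omega>'(1) S(2-4)]
    proof eventually_elim
      case (elim z)
      have "?G z = (\<Sum>k<n. indicator Q (- ?u k + z) *\<^sub>R expo (\<alpha>, \<beta>) z)"
        by (simp only: g_eq)
      also have "\<dots> = indicator \<Omega>' z *\<^sub>R expo (\<alpha>, \<beta>) z"
        by (simp only: elim Q_def scaleR_sum_left)
      finally show ?case .
    qed
    show "?G \<in> borel_measurable borel"
      by (intro borel_measurable_sum measurable_compose[OF _ g_meas]) measurable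
  qed (use \<Omega>' in \<open>auto intro: borel_measurable_lebesgue_on\<close>)
  also have "\<dots> = (\<Sum>k<n. LINT z|lborel. ?g k (- ?u k + z))"
  proof (rule Bochner_Integration.integral_sum)
    fix k
    have "integrable (distr lborel borel ((+) (- ?u k))) (?g k)"
      unfolding lborel_distr_plus using Q_int by (rule integrable_mult_right)
    then show "integrable lborel (\<lambda>z. ?g k (- ?u k + z))"
      by (subst (asm) integrable_distr_eq) auto
  qed
  also have "\<dots> = (\<Sum>k<n. expo (\<alpha>, \<beta>) (?u k) * (LINT z|lborel. indicator Q z *\<^sub>R expo (\<alpha>, \<beta>) z))"
  proof (rule sum.cong[OF refl])
    fix k
    show "(LINT z|lborel. ?g k (- ?u k + z))
        = expo (\<alpha>, \<beta>) (?u k) * (LINT z|lborel. indicator Q z *\<^sub>R expo (\<alpha>, \<beta>) z)"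
      using lborel_integral_translate[OF g_meas, of k "- ?u k"]
      by (simp only: integral_mult_right_zero)
  qed
  finally show ?thesis
    by (simp only: Q_eq sum_distrib_right)
qed

text \<open>Real and imaginary parts are replaced by Borel functions separately. Multiplying by the
  indicator of a Borel subset of \<Omega> makes the result vanish at every point outside \<Omega>,
  not just almost every one.\<close>

lemma lebesgue_on_ex_borel_representative:
  fixes \<Omega> :: "'a::euclidean_space set"
  assumes \<Omega>: "\<Omega> \<in> sets lebesgue" and h: "h \<in> borel_measurable (lebesgue_on \<Omega>)"
  obtains h0 :: "'a \<Rightarrow> complex" where "h0 \<in> borel_measurable borel" "\<And>x. x \<notin> \<Omega> \<Longrightarrow> h0 x = 0"
    "AE x in lborel. h0 x = indicator \<Omega> x *\<^sub>R h x"
proof -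
  from \<Omega> obtain S N where S: "S \<in> sets borel" "S \<subseteq> \<Omega>" "\<Omega> - S \<subseteq> N" "N \<in> null_sets lborel"
    by (rule lebesgue_ex_borel_subset)
  let ?H = "\<lambda>x. indicator \<Omega> x *\<^sub>R h x"
  have [measurable]: "?H \<in> borel_measurable lebesgue"
    using h \<Omega> by (simp add: borel_measurable_restrict_space_iff)
  have "(\<lambda>x. Re (?H x)) \<in> borel_measurable lebesgue" "(\<lambda>x. Im (?H x)) \<in> borel_measurable lebesgue"
    by measurable
  from this[THEN completion_ex_borel_measurable_real]
  obtain r i where ri [measurable]: "r \<in> borel_measurable lborel" "i \<in> borel_measurable lborel"
    and ae: "AE x in lborel. Re (?H x) = r x" "AE x in lborel. Im (?H x) = i x"
    by blast
  let ?h0 = "\<lambda>x. indicator S x *\<^sub>R Complex (r x) (i x)"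
  show ?thesis
  proof
    have "(\<lambda>x. indicator S x *\<^sub>R (complex_of_real (r x) + \<i> * complex_of_real (i x))) \<in> borel_measurable lborel"
      using S(1) by measurable
    then show "?h0 \<in> borel_measurable borel"
      by (simp add: Complex_eq)
    show "?h0 x = 0" if "x \<notin> \<Omega>" for x
      using that S by (auto simp: indicator_def)
    show "AE x in lborel. ?h0 x = ?H x"
      using ae AE_not_in[OF S(4)]
    proof eventually_elim
      case (elim x)
      then have "Complex (r x) (i x) = ?H x" by (simp add: complex_eq_iff)
      then show ?case using elim(3) S(2,3) by (auto simp: indicator_def)
    qed
  qed
qed

text \<open>Support in the lowest slab keeps the Dirichlet kernel out of the inner products.
  Modulating by \<open>expo a\<close> in the last variable shifts the interval factor by
  \<open>a\<close>, so that later the sinc kernel can be centred anywhere.\<close>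

lemma slab_test_function:
  fixes \<Omega> :: "(real ^ 'd) set"
  assumes \<Omega>': "\<Omega> \<times> {0..1} \<subseteq> \<Omega>'" "\<Omega>' \<in> sets lebesgue"
    and \<Omega>: "\<Omega> \<in> lmeasurable" and h: "h \<in> L2_space \<Omega>"
  obtains F where "F \<in> L2_space \<Omega>'" "L2_norm \<Omega>' F = L2_norm \<Omega> h"
    "\<And>\<alpha> \<beta>. L2_inner \<Omega>' F (expo (\<alpha>, \<beta>)) = L2_inner \<Omega> h (expo \<alpha>) * unit_fourier (a - \<beta>)"
proof -
  have \<Omega>_sets: "\<Omega> \<in> sets lebesgue" using \<Omega> by (rule fmeasurableD)
  note h_meas = L2_spaceD(1)[OF h]
  obtain h0 where h0 [measurable]: "h0 \<in> borel_measurable borel" "\<And>x. x \<notin> \<Omega> \<Longrightarrow> h0 x = 0"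
    and ae: "AE x in lborel. h0 x = indicator \<Omega> x *\<^sub>R h x"
    using lebesgue_on_ex_borel_representative[OF \<Omega>_sets h_meas] by blast
  have "AE x in lborel. (cmod (h0 x))\<^sup>2 = indicator \<Omega> x *\<^sub>R (cmod (h x))\<^sup>2"
    using ae by eventually_elim (auto simp: indicator_def)
  note sq = \<Omega>_sets _ _ this
  have sq_int: "(LINT x|lebesgue_on \<Omega>. (cmod (h x))\<^sup>2) = (LINT x|lborel. (cmod (h0 x))\<^sup>2)"
    and "integrable (lebesgue_on \<Omega>) (\<lambda>x. (cmod (h x))\<^sup>2) = integrable lborel (\<lambda>x. (cmod (h0 x))\<^sup>2)"
    using h_meas by (intro integral_lebesgue_on_eq_lborel[OF sq] integrable_lebesgue_on_iff_lborel[OF sq]; simp)+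
  then have sq_integrable: "integrable lborel (\<lambda>x. (cmod (h0 x))\<^sup>2)"
    using L2_spaceD(2)[OF h] by simp
  have "AE x in lborel. h0 x * cnj (expo \<alpha> x) = indicator \<Omega> x *\<^sub>R (h x * cnj (expo \<alpha> x))" for \<alpha>
    using ae by eventually_elim (auto simp: indicator_def)
  note inn = \<Omega>_sets _ _ this
  have h_inner_meas: "(\<lambda>x. h x * cnj (expo \<alpha> x)) \<in> borel_measurable (lebesgue_on \<Omega>)" for \<alpha>
    by (rule borel_measurable_times[OF h_meas borel_measurable_lebesgue_on]) measurable
  have inner_int: "L2_inner \<Omega> h (expo \<alpha>) = (LINT x|lborel. h0 x * cnj (expo \<alpha> x))" for \<alpha>
    unfolding L2_inner_def by (rule integral_lebesgue_on_eq_lborel[OF inn]) (use h_inner_meas in auto)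
  have inner_integrable: "integrable lborel (\<lambda>x. h0 x * cnj (expo \<alpha> x))" for \<alpha>
    using integrable_lebesgue_on_iff_lborel[OF inn, of \<alpha>] h_inner_meas[of \<alpha>]
      L2_inner_integrable[OF h expo_in_L2_space[OF \<Omega>], of \<alpha>] by simp
  let ?I = "\<lambda>s. indicator {0..<1::real} s :: complex"
  define F where "F = (\<lambda>z. h0 (fst z) * (?I (snd z) * expo a (snd z)))"
  have [measurable]: "F \<in> borel_measurable borel"
  proof -
    have "F \<in> borel_measurable (borel \<Otimes>\<^sub>M borel)"
      unfolding F_def by measurable
    then show ?thesis by (simp only: borel_prod)
  qed
  have F_supp: "F z = 0" if "z \<notin> \<Omega>'" for z
  proof -
    have "z \<notin> \<Omega> \<times> {0..1}" using that \<Omega>'(1) by blast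
    then have "fst z \<notin> \<Omega> \<or> snd z \<notin> {0..<1}" by (auto simp: mem_Times_iff)
    then show ?thesis using h0(2) by (auto simp: F_def)
  qed
  have I_int: "integrable lborel (\<lambda>s. ?I s * expo b s)" for b
  proof -
    have "integrable lborel (\<lambda>s. indicator {0..<1} s *\<^sub>R expo b s)"
      by (intro integrableI_bounded_set_indicator[where B=1]) auto
    moreover have "indicator {0..<1} s *\<^sub>R expo b s = ?I s * expo b s" for s
      by (simp add: indicator_def)
    ultimately show ?thesis by (simp only:)
  qed
  have I_eq: "(LINT s|lborel. ?I s * expo b s) = unit_fourier b" for b
    unfolding unit_fourier_def by (intro Bochner_Integration.integral_cong) (auto simp: indicator_def)
  \<comment> \<open>The trivial factor \<open>expo 0\<close> brings the squared modulus into the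
    product form handled by \<open>lborel_integral_product\<close>.\<close>
  have F_sq: "complex_of_real ((cmod (F z))\<^sup>2)
      = complex_of_real ((cmod (h0 (fst z)))\<^sup>2) * (?I (snd z) * expo 0 (snd z))" for z
    by (auto simp: F_def norm_mult indicator_def)
  have F_inner: "F z * cnj (expo (\<alpha>, \<beta>) z)
      = (h0 (fst z) * cnj (expo \<alpha> (fst z))) * (?I (snd z) * expo (a - \<beta>) (snd z))" for z \<alpha> \<beta>
    by (cases z) (simp add: F_def expo_Pair expo_mult_cnj[symmetric])
  have *: "integrable lborel (\<lambda>x. complex_of_real ((cmod (h0 x))\<^sup>2))"
    using sq_integrable by (rule integrable_of_real)
  have "integrable lborel (\<lambda>z. complex_of_real ((cmod (F z))\<^sup>2))"
    unfolding F_sq by (rule lborel_integral_product(1)[OF * I_int])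
  from integrable_Re[OF this] have F_integrable: "integrable lborel (\<lambda>z. (cmod (F z))\<^sup>2)"
    by (simp only: Re_complex_of_real)
  have "(LINT z|lborel. complex_of_real ((cmod (F z))\<^sup>2))
      = (LINT x|lborel. complex_of_real ((cmod (h0 x))\<^sup>2)) * unit_fourier 0"
    unfolding F_sq lborel_integral_product(2)[OF * I_int] I_eq ..
  moreover have "unit_fourier 0 = 1"
    by (simp add: unit_fourier_def)
  ultimately have F_int: "(LINT z|lborel. (cmod (F z))\<^sup>2) = (LINT x|lborel. (cmod (h0 x))\<^sup>2)"
    by (simp only: integral_complex_of_real mult_1_right of_real_eq_iff)
  have F_meas: "F \<in> borel_measurable (lebesgue_on \<Omega>')"
    by (rule borel_measurable_lebesgue_on) measurable
  have "AE z in lborel. (cmod (F z))\<^sup>2 = indicator \<Omega>' z *\<^sub>R (cmod (F z))\<^sup>2"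
    using F_supp by (auto simp: indicator_def)
  note Fsq = \<Omega>'(2) _ _ this
  have Fsq_int: "(LINT z|lebesgue_on \<Omega>'. (cmod (F z))\<^sup>2) = (LINT z|lborel. (cmod (F z))\<^sup>2)"
    and "integrable (lebesgue_on \<Omega>') (\<lambda>z. (cmod (F z))\<^sup>2) = integrable lborel (\<lambda>z. (cmod (F z))\<^sup>2)"
    using F_meas by (intro integral_lebesgue_on_eq_lborel[OF Fsq] integrable_lebesgue_on_iff_lborel[OF Fsq]; simp)+
  show ?thesis
  proof
    show "F \<in> L2_space \<Omega>'"
      using F_meas F_integrable \<open>_ = integrable lborel (\<lambda>z. (cmod (F z))\<^sup>2)\<close> by (simp add: L2_space_def)
    show "L2_norm \<Omega>' F = L2_norm \<Omega> h"
      by (simp add: L2_norm_def sq_int Fsq_int F_int)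
    fix \<alpha> \<beta>
    have "L2_inner \<Omega>' F (expo (\<alpha>, \<beta>)) = (LINT z|lborel. F z * cnj (expo (\<alpha>, \<beta>) z))"
      unfolding L2_inner_def
    proof (rule integral_lebesgue_on_eq_lborel[OF \<Omega>'(2)])
      show "AE z in lborel. F z * cnj (expo (\<alpha>, \<beta>) z) = indicator \<Omega>' z *\<^sub>R (F z * cnj (expo (\<alpha>, \<beta>) z))"
        using F_supp by (auto simp: indicator_def)
    qed (auto intro!: borel_measurable_lebesgue_on)
    also have "\<dots> = L2_inner \<Omega> h (expo \<alpha>) * unit_fourier (a - \<beta>)"
      unfolding F_inner lborel_integral_product(2)[OF inner_integrable I_int] I_eq inner_int ..
    finally show "L2_inner \<Omega>' F (expo (\<alpha>, \<beta>)) = L2_inner \<Omega> h (expo \<alpha>) * unit_fourier (a - \<beta>)" .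
  qed
qed

section \<open>Windows\<close>

lemma expo_scaleR_nat: "expo \<xi> (real k *\<^sub>R u) = expo \<xi> u ^ k"
proof -
  have "expo \<xi> (real k *\<^sub>R u) = exp (of_nat k * (2 * of_real pi * \<i> * of_real (\<xi> \<bullet> u)))"
    unfolding expo_def by (rule arg_cong[where f=exp]) simp
  then show ?thesis by (simp only: exp_of_nat_mult expo_def)
qed

lemma expo_eq_1_iff: "expo \<xi> x = 1 \<longleftrightarrow> \<xi> \<bullet> x \<in> \<int>"
proof -
  have "expo \<xi> x = 1 \<longleftrightarrow> (\<exists>m::int. 2 * pi * (\<xi> \<bullet> x) = of_int (2 * m) * pi)"
    unfolding expo_def by (simp add: exp_eq_1)
  also have "\<dots> \<longleftrightarrow> (\<exists>m::int. \<xi> \<bullet> x = of_int m)"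
    by (simp add: field_simps)
  finally show ?thesis by (auto simp: Ints_def)
qed

text \<open>The sum is geometric with ratio \<open>expo \<xi> u\<close>, so it vanishes only if the
  ratio is an \<open>n\<close>-th root of unity other than \<open>1\<close>. Then
  \<open>n * r\<close> would be an integer of modulus below \<open>1\<close>, hence
  \<open>0\<close>, which makes the ratio \<open>1\<close> after all.\<close>

lemma sum_expo_multiples_nonzero:
  assumes n: "n \<ge> 1" and t: "\<xi> \<bullet> u = of_int m + r" and r: "real n * \<bar>r\<bar> < 1"
  shows "(\<Sum>k<n. expo \<xi> (real k *\<^sub>R u)) \<noteq> 0"
proof (cases "expo \<xi> u = 1")
  case True
  then show ?thesis using n by (simp add: expo_scaleR_nat)
next
  case False
  have "expo \<xi> u ^ n \<noteq> 1"
  proof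
    assume "expo \<xi> u ^ n = 1"
    then have "\<xi> \<bullet> (real n *\<^sub>R u) \<in> \<int>"
      by (simp only: expo_scaleR_nat[symmetric] expo_eq_1_iff)
    then have "real n * (of_int m + r) - of_int (int n * m) \<in> \<int>"
      by (intro Ints_diff) (simp_all add: t)
    then have "real n * r \<in> \<int>" by (simp add: distrib_left)
    then have "real n * r = 0"
      using r by (rule_tac Ints_nonzero_abs_less1) (simp_all add: abs_mult)
    then have "\<xi> \<bullet> u \<in> \<int>" using n t by simp
    then show False using False by (simp add: expo_eq_1_iff)
  qed
  then show ?thesis
    using False by (simp add: expo_scaleR_nat geometric_sum)
qed

text \<open>By \<open>norm_unit_fourier\<close> the zeros are those of \<open>sinc (pi * b)\<close>,
  the nonzero integers.\<close>

lemma unit_fourier_nonzero: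
  assumes "\<bar>b\<bar> < 1"
  shows "unit_fourier b \<noteq> 0"
proof -
  have "sinc (pi * b) \<noteq> 0"
  proof (cases "b = 0")
    case False
    have "sin (pi * b) \<noteq> 0"
    proof
      assume "sin (pi * b) = 0"
      then obtain i :: int where "pi * b = of_int i * pi" by (auto simp: sin_zero_iff_int2)
      then have "b = of_int i" by simp
      then show False using assms False by simp
    qed
    then show ?thesis using False by simp
  qed simp
  then show ?thesis using norm_unit_fourier[of b] by auto
qed

lemma sinc_pi_nonzero_AE: "AE x in lborel. sinc (pi * x) \<noteq> 0"
proof (rule AE_mp)
  have "countable (\<int> :: real set)" by (rule countable_int)
  then show "AE x in lborel. (x::real) \<notin> \<int>"
    by (intro AE_not_in countable_imp_null_set_lborel)
  show "AE x in lborel. x \<notin> \<int> \<longrightarrow> sinc (pi * x) \<noteq> 0"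
    by (rule AE_I2) (auto simp: sin_zero_iff_int2)
qed

text \<open>The combinatorial core, free of Fourier analysis. The \<open>n\<close> colours jointly
  have mass \<open>n * C\<close> in each unit interval by \<open>packing_imp_tiling\<close>, while
  each has at most \<open>C\<close>; hence none can fall short.\<close>

lemma window_tiling:
  fixes w s :: "'i \<Rightarrow> real" and col :: "'i \<Rightarrow> nat"
  assumes w: "\<And>i. 0 \<le> w i" and col: "\<And>i. i \<in> I \<Longrightarrow> col i < n" and C: "0 \<le> C"
    and upper: "\<And>a F. finite F \<Longrightarrow> F \<subseteq> I \<Longrightarrow> (\<Sum>i\<in>F. w i * (sinc (pi * (s i - a)))\<^sup>2) \<le> n * C"
    and lower: "\<And>a \<epsilon>. 0 < \<epsilon> \<Longrightarrow>
      \<exists>F. finite F \<and> F \<subseteq> I \<and> n * C - \<epsilon> < (\<Sum>i\<in>F. w i * (sinc (pi * (s i - a)))\<^sup>2)"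
    and packing: "\<And>a j F. finite F \<Longrightarrow> F \<subseteq> {i\<in>I. s i \<in> {a..<a + 1} \<and> col i = j} \<Longrightarrow> (\<Sum>i\<in>F. w i) \<le> C"
    and j: "j < n" and \<epsilon>: "0 < \<epsilon>"
  shows "\<exists>F. finite F \<and> F \<subseteq> {i\<in>I. s i \<in> {a..<a + 1} \<and> col i = j} \<and> C - \<epsilon> < (\<Sum>i\<in>F. w i)"
proof (cases "C < \<epsilon>")
  case True
  then show ?thesis by (intro exI[of _ "{}"]) simp
next
  case False
  let ?W = "\<lambda>a j. {i\<in>I. s i \<in> {a..<a + 1} \<and> col i = j}"
  \<comment> \<open>Weighted counting measure, pushed to the line so that indices with equal
    \<open>s i\<close> add their weights.\<close>
  define \<mu> where "\<mu> = density (count_space I) (\<lambda>i. ennreal (w i))"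
  define \<nu> where "\<nu> = distr \<mu> borel s"
  have s_meas: "s \<in> borel_measurable \<mu>"
    by (simp add: \<mu>_def)
  have \<nu>_int: "(\<integral>\<^sup>+x. ennreal (f x) \<partial>\<nu>)
      = (SUP F\<in>{F. finite F \<and> F \<subseteq> I}. ennreal (\<Sum>i\<in>F. w i * f (s i)))"
    if f: "f \<in> borel_measurable borel" "\<And>x. 0 \<le> f x" for f :: "real \<Rightarrow> real"
  proof -
    have "(\<integral>\<^sup>+x. ennreal (f x) \<partial>\<nu>) = (\<integral>\<^sup>+i. ennreal (f (s i)) \<partial>\<mu>)"
      unfolding \<nu>_def using f s_meas by (intro nn_integral_distr) auto
    also have "\<dots> = (\<integral>\<^sup>+i. ennreal (w i * f (s i)) \<partial>count_space I)"
      unfolding \<mu>_def using w f by (subst nn_integral_density) (auto simp: ennreal_mult)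
    also have "\<dots> = (SUP F\<in>{F. finite F \<and> F \<subseteq> I}. \<Sum>i\<in>F. ennreal (w i * f (s i)))"
      by (rule nn_integral_count_space_eq_SUP)
    also have "\<dots> = (SUP F\<in>{F. finite F \<and> F \<subseteq> I}. ennreal (\<Sum>i\<in>F. w i * f (s i)))"
      using w f by (intro SUP_cong refl sum_ennreal) auto
    finally show ?thesis .
  qed
  have indicator_sum: "(\<Sum>i\<in>F. w i * indicator {a..<a + 1} (s i)) = (\<Sum>j<n. \<Sum>i\<in>F \<inter> ?W a j. w i)"
    if F: "finite F" "F \<subseteq> I" for F a
  proof -
    have "(\<Sum>j<n. \<Sum>i\<in>F \<inter> ?W a j. w i) = (\<Sum>j<n. \<Sum>i\<in>F. if col i = j then w i * indicator {a..<a + 1} (s i) else 0)"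
      using F by (intro sum.cong refl sum.mono_neutral_cong_left) (auto simp: indicator_def)
    also have "\<dots> = (\<Sum>i\<in>F. \<Sum>j<n. if col i = j then w i * indicator {a..<a + 1} (s i) else 0)"
      by (rule sum.swap)
    also have "\<dots> = (\<Sum>i\<in>F. w i * indicator {a..<a + 1} (s i))"
      using F col by (intro sum.cong refl) (auto simp: subset_iff)
    finally show ?thesis ..
  qed
  have emeasure_\<nu>: "emeasure \<nu> {a..<a + 1}
      = (SUP F\<in>{F. finite F \<and> F \<subseteq> I}. ennreal (\<Sum>i\<in>F. w i * indicator {a..<a + 1} (s i)))" for a
    using \<nu>_int[of "indicator {a..<a + 1}"] by (simp add: ennreal_indicator \<nu>_def)
  have "emeasure \<nu> {a..<a + 1} = ennreal (n * C)"
  proof (rule packing_imp_tiling[where k="\<lambda>x. ennreal ((sinc (pi * x))\<^sup>2)"])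
    show "sets \<nu> = sets borel" by (simp add: \<nu>_def)
    show "(\<integral>\<^sup>+x. ennreal ((sinc (pi * x))\<^sup>2) \<partial>lborel) = 1"
      by (rule nn_integral_sinc_pi_squared)
    show "AE x in lborel. 0 < ennreal ((sinc (pi * x))\<^sup>2)"
      using sinc_pi_nonzero_AE by eventually_elim (simp only: ennreal_less_zero_iff zero_less_power2 simp_thms)
    show "(\<integral>\<^sup>+x. ennreal ((sinc (pi * (x - a)))\<^sup>2) \<partial>\<nu>) = ennreal (n * C)" for a
    proof -
      have m: "(\<lambda>x. sinc (pi * (x - a))) \<in> borel_measurable borel"
        by (rule measurable_compose[OF _ borel_measurable_sinc]) measurable
      have "(\<integral>\<^sup>+x. ennreal ((sinc (pi * (x - a)))\<^sup>2) \<partial>\<nu>)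
          = (SUP F\<in>{F. finite F \<and> F \<subseteq> I}. ennreal (\<Sum>i\<in>F. w i * (sinc (pi * (s i - a)))\<^sup>2))"
        by (rule \<nu>_int[OF borel_measurable_power[OF m] zero_le_power2])
      also have "(SUP F\<in>{F. finite F \<and> F \<subseteq> I}. ennreal (\<Sum>i\<in>F. w i * (sinc (pi * (s i - a)))\<^sup>2)) = ennreal (n * C)"
        (is "?S = _")
      proof (rule antisym)
        show "?S \<le> ennreal (n * C)"
          using upper by (intro SUP_least ennreal_leI) blast
        show "ennreal (n * C) \<le> ?S"
        proof (rule ennreal_le_epsilon)
          fix e :: real assume "0 < e"
          from lower[OF this, of a] obtain F where F: "finite F" "F \<subseteq> I"
            "n * C - e < (\<Sum>i\<in>F. w i * (sinc (pi * (s i - a)))\<^sup>2)" by (elim exE conjE)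
          have "ennreal (n * C) \<le> ennreal ((\<Sum>i\<in>F. w i * (sinc (pi * (s i - a)))\<^sup>2) + e)"
            using F(3) by (intro ennreal_leI) linarith
          also have "\<dots> = ennreal (\<Sum>i\<in>F. w i * (sinc (pi * (s i - a)))\<^sup>2) + ennreal e"
            using \<open>0 < e\<close> w by (intro ennreal_plus sum_nonneg mult_nonneg_nonneg) auto
          also have "\<dots> \<le> ?S + ennreal e"
            using F by (intro add_right_mono SUP_upper) blast
          finally show "ennreal (n * C) \<le> ?S + ennreal e" .
        qed
      qed
      finally show ?thesis .
    qed
    show "emeasure \<nu> {a..<a + 1} \<le> ennreal (n * C)" for a
      unfolding emeasure_\<nu>
    proof (intro SUP_least ennreal_leI)
      fix F assume "F \<in> {F. finite F \<and> F \<subseteq> I}"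
      then have F: "finite F" "F \<subseteq> I" by auto
      have "(\<Sum>j<n. \<Sum>i\<in>F \<inter> ?W a j. w i) \<le> (\<Sum>j<n. C)"
        using F by (intro sum_mono packing[of _ a]) auto
      then show "(\<Sum>i\<in>F. w i * indicator {a..<a + 1} (s i)) \<le> n * C"
        unfolding indicator_sum[OF F] by simp
    qed
  qed auto
  then have "ennreal (n * C) \<le> (SUP F\<in>{F. finite F \<and> F \<subseteq> I}. ennreal (\<Sum>i\<in>F. w i * indicator {a..<a + 1} (s i)))"
    by (simp only: emeasure_\<nu>)
  \<comment> \<open>\<open>ennreal\<close> truncates negative numbers to \<open>0\<close>, so
    strictness needs \<open>n * C > 0\<close>. The case \<open>C < \<epsilon>\<close>, settled by
    the empty set, was split off for this reason.\<close>
  moreover have "ennreal (n * C - \<epsilon>) < ennreal (n * C)"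
  proof (rule ennreal_lessI)
    have "1 * C \<le> n * C" using j C by (intro mult_right_mono) auto
    then show "0 < n * C" using False \<epsilon> by linarith
  qed (use \<epsilon> in simp)
  ultimately have "ennreal (n * C - \<epsilon>) < (SUP F\<in>{F. finite F \<and> F \<subseteq> I}. ennreal (\<Sum>i\<in>F. w i * indicator {a..<a + 1} (s i)))"
    by (rule less_le_trans[rotated])
  then obtain F where F: "finite F" "F \<subseteq> I"
    and "ennreal (n * C - \<epsilon>) < ennreal (\<Sum>i\<in>F. w i * indicator {a..<a + 1} (s i))"
    unfolding less_SUP_iff by blast
  then have "n * C - \<epsilon> < (\<Sum>i\<in>F. w i * indicator {a..<a + 1} (s i))"
    by (meson ennreal_leI not_le)
  \<comment> \<open>Colour \<open>j\<close> is isolated: the other \<open>n - 1\<close> colours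
    account for at most \<open>n * C - C\<close>, so the deficit \<epsilon> falls on
    \<open>j\<close> alone.\<close>
  also have "\<dots> = (\<Sum>i\<in>F \<inter> ?W a j. w i) + (\<Sum>l\<in>{..<n} - {j}. \<Sum>i\<in>F \<inter> ?W a l. w i)"
    unfolding indicator_sum[OF F] using j by (subst sum.remove[of _ j]) auto
  also have "(\<Sum>l\<in>{..<n} - {j}. \<Sum>i\<in>F \<inter> ?W a l. w i) \<le> (\<Sum>l\<in>{..<n} - {j}. C)"
    using F by (intro sum_mono packing[of _ a]) auto
  also have "(\<Sum>l\<in>{..<n} - {j}. C) = n * C - C"
    using j by (simp add: of_nat_diff left_diff_distrib)
  finally have "C - \<epsilon> < (\<Sum>i\<in>F \<inter> ?W a j. w i)" by simp
  then show ?thesis using F by (intro exI[of _ "F \<inter> ?W a j"]) auto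
qed

text \<open>Supplies the hypothesis of \<open>sum_expo_multiples_nonzero\<close> for two frequencies
  of one colour: their fractional parts lie in a common cell of length \<open>1/n\<close>.\<close>

lemma frac_diff_decomp:
  assumes n: "n \<ge> 1" and eq: "\<lfloor>real n * frac x\<rfloor> = \<lfloor>real n * frac y\<rfloor>"
  obtains m :: int and r :: real where "x - y = of_int m + r" "real n * \<bar>r\<bar> < 1"
proof
  show "x - y = of_int (\<lfloor>x\<rfloor> - \<lfloor>y\<rfloor>) + (frac x - frac y)"
    by (simp add: frac_def)
  have "\<bar>real n * frac x - real n * frac y\<bar> < 1"
    using eq by linarith
  then show "real n * \<bar>frac x - frac y\<bar> < 1"
    by (simp add: abs_mult flip: right_diff_distrib)
qed

section \<open>Reduction of the theorem to one window of the spectrum\<close>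

theorem theorem4p1:
  fixes \<Omega> :: "(real ^ 'd) set" and \<Omega>' :: "((real ^ 'd) \<times> real) set"
  assumes "\<Omega> \<in> sets lebesgue" and "emeasure lebesgue \<Omega> < \<infinity>"
    and "is_stacking \<Omega>' \<Omega>"
    and "spectral \<Omega>'"
  shows "spectral \<Omega>"
proof -
  from assms(3) obtain v n where n: "n \<ge> 1"
    and \<Omega>': "\<Omega>' = \<Omega> \<times> {0..1} + (\<lambda>k. real k *\<^sub>R (v, 1)) ` {..<n}"
    unfolding is_stacking_def by (elim exE conjE)
  from assms(4) obtain \<Lambda> where \<Omega>'_sets: "\<Omega>' \<in> sets lebesgue"
    and \<Omega>'_measure: "0 < emeasure lebesgue \<Omega>'" "emeasure lebesgue \<Omega>' < \<infinity>"
    and \<Lambda>: "orthogonal_basis_L2 \<Omega>' \<Lambda> expo"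
    unfolding spectral_def by (elim exE conjE)
  let ?u = "(v, 1::real)"
  define V V' where "V = measure lebesgue \<Omega>" and "V' = measure lebesgue \<Omega>'"
  have \<Omega>_lm: "\<Omega> \<in> lmeasurable" and \<Omega>'_lm: "\<Omega>' \<in> lmeasurable"
    using assms(1,2) \<Omega>'_sets \<Omega>'_measure by (auto intro: fmeasurableI)
  note integral_\<Omega>' = integral_expo_stacking[OF \<Omega>' \<Omega>'_sets \<Omega>_lm]
  \<comment> \<open>The transform formula at frequency zero, where the Dirichlet kernel equals
    \<open>n\<close>. It also transfers positivity of measure from \<Omega>' to \<Omega>.\<close>
  have V'_eq: "V' = n * V"
  proof -
    have "complex_of_real V' = (LINT z|lebesgue_on \<Omega>'. expo (0, 0) z)"
      using L2_inner_expo_self[OF \<Omega>'_lm, of 0] by (simp add: L2_inner_expo V'_def flip: zero_prod_def)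
    also have "\<dots> = (\<Sum>k<n. expo (0, 0) (real k *\<^sub>R ?u)) * ((LINT x|lebesgue_on \<Omega>. expo 0 x) * unit_fourier 0)"
      by (rule integral_\<Omega>')
    also have "(LINT x|lebesgue_on \<Omega>. expo 0 x) = complex_of_real V"
      using L2_inner_expo_self[OF \<Omega>_lm, of 0] by (simp add: L2_inner_expo V_def)
    also have "(\<Sum>k<n. expo (0, 0) (real k *\<^sub>R ?u)) * (complex_of_real V * unit_fourier 0) = complex_of_real (n * V)"
      by (simp add: unit_fourier_def flip: zero_prod_def)
    finally show ?thesis by (simp only: of_real_eq_iff)
  qed
  have V'_pos: "V' > 0"
    using \<Omega>'_measure by (simp add: V'_def measure_def enn2real_positive_iff)
  then have V_pos: "V > 0"
    using n unfolding V'_eq by (simp add: zero_less_mult_iff)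
  have self': "L2_inner \<Omega>' (expo \<xi>) (expo \<xi>) = complex_of_real V'" for \<xi>
    unfolding V'_def by (rule L2_inner_expo_self[OF \<Omega>'_lm])
  have *: "orthogonal_basis_L2 \<Omega>' \<Lambda> expo \<longleftrightarrow>
    (\<forall>p\<in>\<Lambda>. \<forall>q\<in>\<Lambda>. p \<noteq> q \<longrightarrow> L2_inner \<Omega>' (expo p) (expo q) = 0) \<and>
    (\<forall>f\<in>L2_space \<Omega>'. \<forall>\<epsilon>>0. \<exists>F. finite F \<and> F \<subseteq> \<Lambda> \<and>
      V' * (L2_norm \<Omega>' f)\<^sup>2 - \<epsilon> < (\<Sum>p\<in>F. (cmod (L2_inner \<Omega>' f (expo p)))\<^sup>2))"
    by (rule orthogonal_basis_L2_iff_Parseval[OF expo_in_L2_space[OF \<Omega>'_lm] self' V'_pos])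
  note basis = iffD1[OF * \<Lambda>, THEN conjunct1, rule_format]
    and Parseval = iffD1[OF * \<Lambda>, THEN conjunct2, rule_format]
  define col where "col = (\<lambda>p. nat \<lfloor>real n * frac (p \<bullet> ?u)\<rfloor>)"
  have col_floor: "int (col p) = \<lfloor>real n * frac (p \<bullet> ?u)\<rfloor>" for p
    by (simp add: col_def)
  have col_less: "col p < n" for p
  proof -
    have "real n * frac (p \<bullet> ?u) < real n * 1"
      using n frac_lt_1 by (intro mult_strict_left_mono) auto
    then have "\<lfloor>real n * frac (p \<bullet> ?u)\<rfloor> < int n" by (simp add: floor_less_iff)
    then show ?thesis using n by (simp add: col_def)
  qed
  \<comment> \<open>The transform of \<Omega>' vanishes at \<open>p - q\<close>. Equal colours keep
    the Dirichlet kernel nonzero, and last coordinates less than \<open>1\<close> apart keep the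
    interval factor nonzero, so the factor from \<Omega> must vanish.\<close>
  have orth: "L2_inner \<Omega> (expo (fst p)) (expo (fst q)) = 0"
    if "p \<in> \<Lambda>" "q \<in> \<Lambda>" "p \<noteq> q" "snd p \<in> {a..<a + 1}" "snd q \<in> {a..<a + 1}" "col p = col q" for p q a
  proof -
    have "\<lfloor>real n * frac (p \<bullet> ?u)\<rfloor> = \<lfloor>real n * frac (q \<bullet> ?u)\<rfloor>"
      using that(6) by (simp only: col_floor[symmetric])
    then obtain m :: int and r where mr: "p \<bullet> ?u - q \<bullet> ?u = of_int m + r" "real n * \<bar>r\<bar> < 1"
      using frac_diff_decomp[OF n] by blast
    have "(p - q) \<bullet> ?u = of_int m + r"
      using mr(1) by (simp only: inner_diff_left)
    from sum_expo_multiples_nonzero[OF n this mr(2)]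
    have "(\<Sum>k<n. expo (p - q) (real k *\<^sub>R ?u)) \<noteq> 0" .
    moreover have "unit_fourier (snd (p - q)) \<noteq> 0"
      using that(4,5) by (intro unit_fourier_nonzero) auto
    moreover have "(\<Sum>k<n. expo (p - q) (real k *\<^sub>R ?u))
        * ((LINT x|lebesgue_on \<Omega>. expo (fst (p - q)) x) * unit_fourier (snd (p - q))) = 0"
      using basis[OF that(1-3)] integral_\<Omega>'[of "fst (p - q)" "snd (p - q)"]
      unfolding L2_inner_expo by (simp only: prod.collapse)
    ultimately have "(LINT x|lebesgue_on \<Omega>. expo (fst (p - q)) x) = 0" by simp
    then show ?thesis by (simp only: L2_inner_expo fst_diff)
  qed
  have self: "L2_inner \<Omega> (expo \<xi>) (expo \<xi>) = complex_of_real V" for \<xi>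
    unfolding V_def by (rule L2_inner_expo_self[OF \<Omega>_lm])
  \<comment> \<open>\<open>0 + 1\<close> is left unsimplified to match the form
    \<open>{a..<a + 1}\<close> in \<open>window_tiling\<close>.\<close>
  define W where "W = {p \<in> \<Lambda>. snd p \<in> {0..<0 + 1} \<and> col p = 0}"
  \<comment> \<open>Two points of \<open>W\<close> with the same first component would make an
    exponential orthogonal to itself, although its squared norm is \<open>V > 0\<close>.\<close>
  have inj: "inj_on fst W"
  proof (rule inj_onI, rule ccontr)
    fix p q assume *: "p \<in> W" "q \<in> W" "fst p = fst q" "p \<noteq> q"
    then have "L2_inner \<Omega> (expo (fst p)) (expo (fst q)) = 0"
      unfolding W_def by (intro orth[of _ _ 0]) auto
    then show False using self[of "fst q"] V_pos *(3) by simp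
  qed
  \<comment> \<open>\<open>W\<close> is fixed before \<open>h\<close>. The tiling argument is run
    anew for each \<open>h\<close>, with weights depending on \<open>h\<close> but always on the
    same window.\<close>
  have window: "\<exists>F. finite F \<and> F \<subseteq> W \<and> V * (L2_norm \<Omega> h)\<^sup>2 - \<epsilon> < (\<Sum>p\<in>F. (cmod (L2_inner \<Omega> h (expo (fst p))))\<^sup>2)"
    if h: "h \<in> L2_space \<Omega>" and \<epsilon>: "0 < \<epsilon>" for h \<epsilon>
    unfolding W_def
  proof (rule window_tiling)
    let ?w = "\<lambda>p. (cmod (L2_inner \<Omega> h (expo (fst p))))\<^sup>2"
    let ?C = "V * (L2_norm \<Omega> h)\<^sup>2"
    show "0 \<le> ?C" using V_pos by simp
    have sub: "\<Omega> \<times> {0..1} \<subseteq> \<Omega>'"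
    proof
      fix z assume z: "z \<in> \<Omega> \<times> {0..1::real}"
      have "z + real 0 *\<^sub>R ?u \<in> \<Omega>'"
        unfolding \<Omega>' by (rule set_plus_intro[OF z image_eqI[OF refl]]) (use n in simp)
      then show "z \<in> \<Omega>'" by (simp flip: zero_prod_def)
    qed
    have test: "\<exists>f \<in> L2_space \<Omega>'. (L2_norm \<Omega>' f)\<^sup>2 = (L2_norm \<Omega> h)\<^sup>2 \<and>
        (\<forall>p. (cmod (L2_inner \<Omega>' f (expo p)))\<^sup>2 = ?w p * (sinc (pi * (snd p - a)))\<^sup>2)" for a
    proof -
      obtain f where f: "f \<in> L2_space \<Omega>'" "L2_norm \<Omega>' f = L2_norm \<Omega> h"
        "\<And>\<alpha> \<beta>. L2_inner \<Omega>' f (expo (\<alpha>, \<beta>)) = L2_inner \<Omega> h (expo \<alpha>) * unit_fourier (a - \<beta>)"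
        using slab_test_function[OF sub \<Omega>'_sets \<Omega>_lm h] by metis
      have "(cmod (L2_inner \<Omega>' f (expo p)))\<^sup>2 = ?w p * (sinc (pi * (snd p - a)))\<^sup>2" for p
      proof -
        have "(cmod (L2_inner \<Omega>' f (expo p)))\<^sup>2 = ?w p * (sinc (pi * (a - snd p)))\<^sup>2"
          using f(3)[of "fst p" "snd p"]
          by (simp only: prod.collapse norm_mult power_mult_distrib norm_unit_fourier)
        also have "pi * (a - snd p) = - (pi * (snd p - a))" by (simp add: algebra_simps)
        finally show ?thesis by (simp only: sinc_neg)
      qed
      then show ?thesis
        using f(1,2) by (intro bexI[of _ f] conjI allI) (simp_all only:)
    qed
    show "(\<Sum>p\<in>F. ?w p * (sinc (pi * (snd p - a)))\<^sup>2) \<le> n * ?C" if F: "finite F" "F \<subseteq> \<Lambda>" for a F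
    proof -
      obtain f where f: "f \<in> L2_space \<Omega>'" "(L2_norm \<Omega>' f)\<^sup>2 = (L2_norm \<Omega> h)\<^sup>2"
        "\<And>p. (cmod (L2_inner \<Omega>' f (expo p)))\<^sup>2 = ?w p * (sinc (pi * (snd p - a)))\<^sup>2"
        using test[of a] by (elim bexE conjE) blast
      \<comment> \<open>Bessel on \<Omega>' has the constant \<open>V' = n * V\<close>, which is the
        level \<open>n * ?C\<close>; Parseval for the same test function gives the matching lower
        bound.\<close>
      have "(\<Sum>p\<in>F. (cmod (L2_inner \<Omega>' f (expo p)))\<^sup>2) \<le> V' * (L2_norm \<Omega>' f)\<^sup>2"
      proof (rule Bessel_inequality[OF F(1) f(1) expo_in_L2_space[OF \<Omega>'_lm] _ self' V'_pos])
        fix p q assume "p \<in> F" "q \<in> F" "p \<noteq> q"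
        then show "L2_inner \<Omega>' (expo p) (expo q) = 0"
          using F(2) by (intro basis) (auto dest: subsetD)
      qed
      then show ?thesis by (simp only: f V'_eq mult.assoc)
    qed
    show "\<exists>F. finite F \<and> F \<subseteq> \<Lambda> \<and> n * ?C - \<epsilon> < (\<Sum>p\<in>F. ?w p * (sinc (pi * (snd p - a)))\<^sup>2)"
      if \<epsilon>: "0 < \<epsilon>" for a \<epsilon>
    proof -
      obtain f where f: "f \<in> L2_space \<Omega>'" "(L2_norm \<Omega>' f)\<^sup>2 = (L2_norm \<Omega> h)\<^sup>2"
        "\<And>p. (cmod (L2_inner \<Omega>' f (expo p)))\<^sup>2 = ?w p * (sinc (pi * (snd p - a)))\<^sup>2"
        using test[of a] by (elim bexE conjE) blast
      show ?thesis using Parseval[OF f(1) \<epsilon>] by (simp only: f V'_eq mult.assoc)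
    qed
    show "(\<Sum>p\<in>F. ?w p) \<le> ?C"
      if F: "finite F" "F \<subseteq> {p \<in> \<Lambda>. snd p \<in> {a..<a + 1} \<and> col p = j}" for a j F
    proof (rule Bessel_inequality[where e="\<lambda>p. expo (fst p)", OF F(1) h expo_in_L2_space[OF \<Omega>_lm] _ self V_pos])
      fix p q assume pq: "p \<in> F" "q \<in> F" "p \<noteq> q"
      from subsetD[OF F(2) pq(1)] subsetD[OF F(2) pq(2)] pq(3)
      show "L2_inner \<Omega> (expo (fst p)) (expo (fst q)) = 0"
        by (intro orth[of _ _ a]) simp_all
    qed
  qed (use col_less n \<epsilon> in auto)
  have "orthogonal_basis_L2 \<Omega> (fst ` W) expo"
  proof (rule orthogonal_basis_L2_iff_Parseval[OF expo_in_L2_space[OF \<Omega>_lm] self V_pos, THEN iffD2], intro conjI ballI allI impI)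
    fix \<xi> \<eta> assume "\<xi> \<in> fst ` W" "\<eta> \<in> fst ` W" "\<xi> \<noteq> \<eta>"
    then obtain p q where "\<xi> = fst p" "\<eta> = fst q" "p \<in> W" "q \<in> W" "p \<noteq> q" by blast
    then show "L2_inner \<Omega> (expo \<xi>) (expo \<eta>) = 0"
      unfolding W_def by (auto intro!: orth[of _ _ 0])
  next
    fix h and \<epsilon> :: real assume "h \<in> L2_space \<Omega>" "0 < \<epsilon>"
    from window[OF this] obtain F where F: "finite F" "F \<subseteq> W"
      "V * (L2_norm \<Omega> h)\<^sup>2 - \<epsilon> < (\<Sum>p\<in>F. (cmod (L2_inner \<Omega> h (expo (fst p))))\<^sup>2)"
      by (elim exE conjE)
    have "(\<Sum>p\<in>F. (cmod (L2_inner \<Omega> h (expo (fst p))))\<^sup>2) = (\<Sum>\<xi>\<in>fst ` F. (cmod (L2_inner \<Omega> h (expo \<xi>)))\<^sup>2)"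
      using inj_on_subset[OF inj F(2)] by (simp add: sum.reindex)
    with F show "\<exists>F. finite F \<and> F \<subseteq> fst ` W \<and>
        V * (L2_norm \<Omega> h)\<^sup>2 - \<epsilon> < (\<Sum>\<xi>\<in>F. (cmod (L2_inner \<Omega> h (expo \<xi>)))\<^sup>2)"
      by (intro exI[of _ "fst ` F"] conjI finite_imageI image_mono) simp_all
  qed
  moreover have "0 < emeasure lebesgue \<Omega>"
    using V_pos unfolding V_def measure_def by (simp add: enn2real_positive_iff)
  ultimately show ?thesis
    unfolding spectral_def using assms(1,2) by blast
qed

end
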